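(* A finite abelian group $G$ is an ecut group if and only if either $G$ is a cyclic group of order $5$, $8$ or $12$, or the exponent of $G$ divides $4$ or $6$.
   Context: For a finite group $G$, the group $\mathcal{Z}(\mathrm{U}(\mathbb{Z}G))$ of central units of the integral group ring $\mathbb{Z}G$ equals $\pm\mathcal{Z}(G)\times A_G$ with $A_G$ free abelian of finite rank; this rank is denoted $\rho(G)$. $G$ is called an ecut (extended cut) group if $\rho(G)\le 1$. *)

theory Defs
  imports "HOL-Algebra.Algebra"
begin

text \<open>
  The integral group ring of a finite group \<open>G\<close>.  Its elements are the integer-valued functions
  vanishing outside \<open>carrier G\<close>, where \<open>f\<close> stands for the formal sum of all \<open>f x \<cdot> x\<close>, and
  the product is convolution.  There is no finite-support condition, so for infinite \<open>G\<close> this is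
  not the group ring.
\<close>

definition integral_group_ring :: "('a, 'b) monoid_scheme \<Rightarrow> ('a \<Rightarrow> int) ring" where
  "integral_group_ring G =
     \<lparr>carrier = {f. \<forall>x. x \<notin> carrier G \<longrightarrow> f x = 0},
      monoid.mult = (\<lambda>f g z. if z \<in> carrier G
                       then \<Sum>x\<in>carrier G. f x * g (inv\<^bsub>G\<^esub> x \<otimes>\<^bsub>G\<^esub> z) else 0),
      one = (\<lambda>x. if x = \<one>\<^bsub>G\<^esub> then 1 else 0),
      ring.zero = (\<lambda>x. 0),
      add = (\<lambda>f g x. f x + g x)\<rparr>"

definition group_element :: "'a \<Rightarrow> 'a \<Rightarrow> int" where
  "group_element g = (\<lambda>x. if x = g then 1 else 0)"

definition center :: "('a, 'b) monoid_scheme \<Rightarrow> 'a set" where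
  "center G = {z \<in> carrier G. \<forall>x\<in>carrier G. z \<otimes>\<^bsub>G\<^esub> x = x \<otimes>\<^bsub>G\<^esub> z}"

definition central_units :: "('a, 'b) monoid_scheme \<Rightarrow> ('a \<Rightarrow> int) monoid" where
  "central_units G =
     (let U = units_of (integral_group_ring G) in U\<lparr>carrier := center U\<rparr>)"

definition trivial_central_units :: "('a, 'b) monoid_scheme \<Rightarrow> ('a \<Rightarrow> int) set" where
  "trivial_central_units G =
     group_element ` center G \<union> (\<lambda>z. \<ominus>\<^bsub>integral_group_ring G\<^esub> group_element z) ` center G"

text \<open>
  \<open>central_unit_rank G r\<close> says that \<open>\<rho>(G) = r\<close>: the group of central units is the internal
  direct product of \<open>\<plusminus>Z(G)\<close> and a free abelian group of rank \<open>r\<close>.  It is a relation rather than a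
  function, so that no junk value arises when there is no such decomposition; that \<open>r\<close> does not depend
  on the decomposition is \<open>central_unit_rank_unique\<close> below.
\<close>

definition central_unit_rank :: "('a, 'b) monoid_scheme \<Rightarrow> nat \<Rightarrow> bool" where
  "central_unit_rank G r \<longleftrightarrow>
     (\<exists>A. subgroup A (central_units G) \<and>
          (\<lambda>(t, a). t \<otimes>\<^bsub>central_units G\<^esub> a)
            \<in> iso ((central_units G)\<lparr>carrier := trivial_central_units G\<rparr> \<times>\<times>
                   (central_units G)\<lparr>carrier := A\<rparr>) (central_units G) \<and>
          (central_units G)\<lparr>carrier := A\<rparr> \<cong> free_Abelian_group {..<r})"

definition ecut :: "('a, 'b) monoid_scheme \<Rightarrow> bool" where
  "ecut G \<longleftrightarrow> (\<exists>r. central_unit_rank G r \<and> r \<le> 1)"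

definition group_exponent :: "('a, 'b) monoid_scheme \<Rightarrow> nat" where
  "group_exponent G = (LEAST n. 0 < n \<and> (\<forall>x\<in>carrier G. x [^]\<^bsub>G\<^esub> n = \<one>\<^bsub>G\<^esub>))"

lemma ring_integral_group_ring:
  assumes "group G" "finite (carrier G)"
  shows "ring (integral_group_ring G)" (is "ring ?R")
proof -
  interpret group G by fact
  note fin = assms(2)
  note d = integral_group_ring_def
  have assoc: "(\<Sum>y\<in>carrier G. (\<Sum>x\<in>carrier G. f x * g (inv\<^bsub>G\<^esub> x \<otimes>\<^bsub>G\<^esub> y)) * h (inv\<^bsub>G\<^esub> y \<otimes>\<^bsub>G\<^esub> z))
      = (\<Sum>x\<in>carrier G. f x * (\<Sum>w\<in>carrier G. g w * h (inv\<^bsub>G\<^esub> w \<otimes>\<^bsub>G\<^esub> (inv\<^bsub>G\<^esub> x \<otimes>\<^bsub>G\<^esub> z))))"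
    if z: "z \<in> carrier G" for f g h :: "'a \<Rightarrow> int" and z
  proof -
    have "(\<Sum>y\<in>carrier G. g (inv\<^bsub>G\<^esub> x \<otimes>\<^bsub>G\<^esub> y) * h (inv\<^bsub>G\<^esub> y \<otimes>\<^bsub>G\<^esub> z))
        = (\<Sum>w\<in>carrier G. g w * h (inv\<^bsub>G\<^esub> w \<otimes>\<^bsub>G\<^esub> (inv\<^bsub>G\<^esub> x \<otimes>\<^bsub>G\<^esub> z)))" if x: "x \<in> carrier G" for x
    proof -
      have can: "x \<otimes>\<^bsub>G\<^esub> (inv\<^bsub>G\<^esub> x \<otimes>\<^bsub>G\<^esub> u) = u" "inv\<^bsub>G\<^esub> x \<otimes>\<^bsub>G\<^esub> (x \<otimes>\<^bsub>G\<^esub> u) = u" if "u \<in> carrier G" for u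
        using x that by (simp_all add: m_assoc[symmetric])
      show ?thesis
        by (rule sum.reindex_bij_witness[of _ "\<lambda>w. x \<otimes>\<^bsub>G\<^esub> w" "\<lambda>y. inv\<^bsub>G\<^esub> x \<otimes>\<^bsub>G\<^esub> y"])
          (use x z in \<open>simp_all add: can inv_mult_group m_assoc\<close>)
    qed
    then have "(\<Sum>x\<in>carrier G. f x * (\<Sum>w\<in>carrier G. g w * h (inv\<^bsub>G\<^esub> w \<otimes>\<^bsub>G\<^esub> (inv\<^bsub>G\<^esub> x \<otimes>\<^bsub>G\<^esub> z))))
       = (\<Sum>x\<in>carrier G. \<Sum>y\<in>carrier G. f x * (g (inv\<^bsub>G\<^esub> x \<otimes>\<^bsub>G\<^esub> y) * h (inv\<^bsub>G\<^esub> y \<otimes>\<^bsub>G\<^esub> z)))"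
      by (simp add: sum_distrib_left[symmetric])
    also have "\<dots> = (\<Sum>y\<in>carrier G. \<Sum>x\<in>carrier G. f x * (g (inv\<^bsub>G\<^esub> x \<otimes>\<^bsub>G\<^esub> y) * h (inv\<^bsub>G\<^esub> y \<otimes>\<^bsub>G\<^esub> z)))"
      by (rule sum.swap)
    finally show ?thesis by (simp add: sum_distrib_right mult.assoc)
  qed
  have one_r: "(\<Sum>x\<in>carrier G. f x * (if inv\<^bsub>G\<^esub> x \<otimes>\<^bsub>G\<^esub> z = \<one>\<^bsub>G\<^esub> then 1 else 0)) = f z"
    if z: "z \<in> carrier G" for f :: "'a \<Rightarrow> int" and z
  proof -
    have "(\<Sum>x\<in>carrier G. f x * (if inv\<^bsub>G\<^esub> x \<otimes>\<^bsub>G\<^esub> z = \<one>\<^bsub>G\<^esub> then 1 else 0))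
        = (\<Sum>x\<in>carrier G. if x = z then f x else 0)"
    proof (rule sum.cong[OF refl])
      fix x assume x: "x \<in> carrier G"
      have "inv\<^bsub>G\<^esub> x \<otimes>\<^bsub>G\<^esub> z = \<one>\<^bsub>G\<^esub> \<longleftrightarrow> x = z"
        using x z by (metis inv_solve_left' r_one one_closed)
      then show "f x * (if inv\<^bsub>G\<^esub> x \<otimes>\<^bsub>G\<^esub> z = \<one>\<^bsub>G\<^esub> then 1 else 0) = (if x = z then f x else 0)"
        by simp
    qed
    then show ?thesis using z fin by simp
  qed
  have one_l: "(\<Sum>x\<in>carrier G. (if x = \<one>\<^bsub>G\<^esub> then 1 else 0) * f (inv\<^bsub>G\<^esub> x \<otimes>\<^bsub>G\<^esub> z)) = f z"
    if z: "z \<in> carrier G" for f :: "'a \<Rightarrow> int" and z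
  proof -
    have "(\<Sum>x\<in>carrier G. (if x = \<one>\<^bsub>G\<^esub> then 1 else 0) * f (inv\<^bsub>G\<^esub> x \<otimes>\<^bsub>G\<^esub> z))
        = (\<Sum>x\<in>carrier G. if x = \<one>\<^bsub>G\<^esub> then f (inv\<^bsub>G\<^esub> x \<otimes>\<^bsub>G\<^esub> z) else 0)"
      by (intro sum.cong) auto
    then show ?thesis using z fin by simp
  qed
  have "abelian_group ?R"
  proof (rule abelian_groupI)
    fix f assume "f \<in> carrier ?R"
    then have "(\<lambda>x. - f x) \<in> carrier ?R \<and> (\<lambda>x. - f x) \<oplus>\<^bsub>?R\<^esub> f = \<zero>\<^bsub>?R\<^esub>" by (auto simp: d)
    then show "\<exists>g\<in>carrier ?R. g \<oplus>\<^bsub>?R\<^esub> f = \<zero>\<^bsub>?R\<^esub>" by blast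
  qed (auto simp: d)
  moreover have "monoid ?R"
    by (rule monoidI) (auto simp: d fun_eq_iff one_l one_r assoc)
  ultimately show ?thesis
    by (rule ringI) (auto simp: d fun_eq_iff algebra_simps sum.distrib)
qed

lemma subgroup_center:
  assumes "group U"
  shows "subgroup (center U) U"
proof -
  interpret U: group U by fact
  show ?thesis
  proof (rule U.subgroupI)
    fix a assume "a \<in> center U"
    then have a: "a \<in> carrier U" "\<And>x. x \<in> carrier U \<Longrightarrow> a \<otimes>\<^bsub>U\<^esub> x = x \<otimes>\<^bsub>U\<^esub> a"
      by (auto simp: center_def)
    have "inv\<^bsub>U\<^esub> a \<otimes>\<^bsub>U\<^esub> x = x \<otimes>\<^bsub>U\<^esub> inv\<^bsub>U\<^esub> a" if "x \<in> carrier U" for x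
      using a that by (metis U.inv_closed U.inv_solve_left U.inv_solve_right U.m_assoc U.m_closed)
    then show "inv\<^bsub>U\<^esub> a \<in> center U" using a by (auto simp: center_def)
    fix b assume "b \<in> center U"
    then have b: "b \<in> carrier U" "\<And>x. x \<in> carrier U \<Longrightarrow> b \<otimes>\<^bsub>U\<^esub> x = x \<otimes>\<^bsub>U\<^esub> b"
      by (auto simp: center_def)
    have "(a \<otimes>\<^bsub>U\<^esub> b) \<otimes>\<^bsub>U\<^esub> x = x \<otimes>\<^bsub>U\<^esub> (a \<otimes>\<^bsub>U\<^esub> b)" if x: "x \<in> carrier U" for x
    proof -
      have "(a \<otimes>\<^bsub>U\<^esub> b) \<otimes>\<^bsub>U\<^esub> x = a \<otimes>\<^bsub>U\<^esub> (x \<otimes>\<^bsub>U\<^esub> b)"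
        using a(1) b x by (simp add: U.m_assoc)
      also have "\<dots> = (a \<otimes>\<^bsub>U\<^esub> x) \<otimes>\<^bsub>U\<^esub> b"
        using a(1) b(1) x by (simp add: U.m_assoc)
      also have "\<dots> = (x \<otimes>\<^bsub>U\<^esub> a) \<otimes>\<^bsub>U\<^esub> b"
        using a(2)[OF x] by simp
      also have "\<dots> = x \<otimes>\<^bsub>U\<^esub> (a \<otimes>\<^bsub>U\<^esub> b)"
        using a(1) b(1) x by (simp add: U.m_assoc)
      finally show ?thesis .
    qed
    then show "a \<otimes>\<^bsub>U\<^esub> b \<in> center U"
      using a(1) b(1) by (simp add: center_def)
  next
    have "\<one>\<^bsub>U\<^esub> \<in> center U" by (auto simp: center_def)
    then show "center U \<noteq> {}" by blast
  qed (auto simp: center_def)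
qed

lemma group_central_units:
  assumes "group G" "finite (carrier G)"
  shows "group (central_units G)"
proof -
  define U where "U = units_of (integral_group_ring G)"
  interpret R: ring "integral_group_ring G" using assms by (rule ring_integral_group_ring)
  interpret U: group U unfolding U_def by (rule R.units_group)
  show ?thesis
    using subgroup_center[OF U.is_group]
    by (simp add: central_units_def U_def[symmetric] Let_def U.subgroup_imp_group)
qed

lemma subgroup_trivial_central_units:
  assumes "group G" "finite (carrier G)"
  shows "subgroup (trivial_central_units G) (central_units G)"
proof -
  interpret group G by fact
  note fin = assms(2)
  define R where "R = integral_group_ring G"
  interpret R: ring R unfolding R_def using assms by (rule ring_integral_group_ring)
  note d = R_def integral_group_ring_def
  have left: "(group_element z \<otimes>\<^bsub>R\<^esub> f) y = f (inv\<^bsub>G\<^esub> z \<otimes>\<^bsub>G\<^esub> y)"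
    if "z \<in> carrier G" "y \<in> carrier G" for z f y
  proof -
    have "(group_element z \<otimes>\<^bsub>R\<^esub> f) y
        = (\<Sum>x\<in>carrier G. if x = z then f (inv\<^bsub>G\<^esub> x \<otimes>\<^bsub>G\<^esub> y) else 0)"
      using that by (auto simp: d group_element_def intro!: sum.cong)
    then show ?thesis using that fin by simp
  qed
  have right: "(f \<otimes>\<^bsub>R\<^esub> group_element z) y = f (y \<otimes>\<^bsub>G\<^esub> inv\<^bsub>G\<^esub> z)"
    if z: "z \<in> carrier G" and y: "y \<in> carrier G" for z f y
  proof -
    have "inv\<^bsub>G\<^esub> x \<otimes>\<^bsub>G\<^esub> y = z \<longleftrightarrow> x = y \<otimes>\<^bsub>G\<^esub> inv\<^bsub>G\<^esub> z" if "x \<in> carrier G" for x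
      using z y that by (metis inv_closed inv_solve_left' inv_solve_right)
    then have "(f \<otimes>\<^bsub>R\<^esub> group_element z) y
        = (\<Sum>x\<in>carrier G. if x = y \<otimes>\<^bsub>G\<^esub> inv\<^bsub>G\<^esub> z then f x else 0)"
      using z y by (auto simp: d group_element_def intro!: sum.cong)
    then show ?thesis using z y fin by simp
  qed
  have clos: "group_element z \<in> carrier R" if "z \<in> carrier G" for z
    using that by (auto simp: d group_element_def)
  have ext: "f = g" if "f \<in> carrier R" "g \<in> carrier R" "\<And>y. y \<in> carrier G \<Longrightarrow> f y = g y" for f g
  proof
    fix y show "f y = g y" using that by (cases "y \<in> carrier G") (auto simp: d)
  qed
  have inv: "group_element z \<otimes>\<^bsub>R\<^esub> group_element (inv\<^bsub>G\<^esub> z) = \<one>\<^bsub>R\<^esub>" if z: "z \<in> carrier G" for z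
  proof (rule ext)
    fix y assume y: "y \<in> carrier G"
    have "inv\<^bsub>G\<^esub> z \<otimes>\<^bsub>G\<^esub> y = inv\<^bsub>G\<^esub> z \<longleftrightarrow> y = \<one>\<^bsub>G\<^esub>"
      using z y by (simp add: l_cancel_one)
    then show "(group_element z \<otimes>\<^bsub>R\<^esub> group_element (inv\<^bsub>G\<^esub> z)) y = \<one>\<^bsub>R\<^esub> y"
      using z y by (simp add: left) (simp add: group_element_def d)
  qed (use z clos in auto)
  have units: "group_element z \<in> Units R" if z: "z \<in> carrier G" for z
    using inv[OF z] inv[of "inv\<^bsub>G\<^esub> z"] clos z by (auto simp: Units_def)
  have comm: "group_element z \<otimes>\<^bsub>R\<^esub> f = f \<otimes>\<^bsub>R\<^esub> group_element z"
    if z: "z \<in> center G" and f: "f \<in> carrier R" for z f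
  proof (rule ext)
    have zG: "z \<in> carrier G" using z by (simp add: center_def)
    show "group_element z \<otimes>\<^bsub>R\<^esub> f \<in> carrier R" "f \<otimes>\<^bsub>R\<^esub> group_element z \<in> carrier R"
      using clos[OF zG] f by auto
    fix y assume y: "y \<in> carrier G"
    have "inv\<^bsub>G\<^esub> z \<otimes>\<^bsub>G\<^esub> y = y \<otimes>\<^bsub>G\<^esub> inv\<^bsub>G\<^esub> z"
    proof -
      have "z \<otimes>\<^bsub>G\<^esub> y = y \<otimes>\<^bsub>G\<^esub> z" using z y by (simp add: center_def)
      then show ?thesis
        using zG y by (metis inv_closed inv_solve_left inv_solve_right m_assoc m_closed)
    qed
    then show "(group_element z \<otimes>\<^bsub>R\<^esub> f) y = (f \<otimes>\<^bsub>R\<^esub> group_element z) y"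
      using zG y by (simp add: left right)
  qed
  have "group_element z \<in> center (units_of R) \<and> \<ominus>\<^bsub>R\<^esub> group_element z \<in> center (units_of R)"
    if z: "z \<in> center G" for z
  proof -
    have zG: "z \<in> carrier G" using z by (simp add: center_def)
    have neg: "\<ominus>\<^bsub>R\<^esub> group_element z \<in> Units R"
      using R.Units_m_closed[OF R.Units_minus_one_closed units[OF zG]] clos[OF zG]
      by (simp add: R.l_minus)
    show ?thesis
      using units[OF zG] neg comm[OF z] clos[OF zG]
      by (auto simp: center_def units_of_def R.l_minus R.r_minus R.Units_closed)
  qed
  then have sub: "trivial_central_units G \<subseteq> carrier (central_units G)"
    by (auto simp: trivial_central_units_def central_units_def R_def Let_def)
  have prod: "group_element z \<otimes>\<^bsub>R\<^esub> group_element w = group_element (z \<otimes>\<^bsub>G\<^esub> w)"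
    if z: "z \<in> carrier G" and w: "w \<in> carrier G" for z w
  proof (rule ext)
    fix y assume y: "y \<in> carrier G"
    have "inv\<^bsub>G\<^esub> z \<otimes>\<^bsub>G\<^esub> y = w \<longleftrightarrow> y = z \<otimes>\<^bsub>G\<^esub> w"
      using z w y by (metis inv_solve_left')
    then show "(group_element z \<otimes>\<^bsub>R\<^esub> group_element w) y = group_element (z \<otimes>\<^bsub>G\<^esub> w) y"
      using z y by (simp add: left) (simp add: group_element_def)
  qed (use z w clos in auto)
  have multZ: "x \<otimes>\<^bsub>central_units G\<^esub> y = x \<otimes>\<^bsub>R\<^esub> y" for x y
    by (simp add: central_units_def Let_def units_of_def R_def)
  have oneZ: "\<one>\<^bsub>central_units G\<^esub> = \<one>\<^bsub>R\<^esub>"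
    by (simp add: central_units_def Let_def units_of_def R_def)
  interpret C: subgroup "center G" G by (rule subgroup_center[OF is_group])
  interpret Z: group "central_units G" using assms by (rule group_central_units)
  have T: "x \<in> trivial_central_units G \<longleftrightarrow>
      (\<exists>z\<in>center G. x = group_element z \<or> x = \<ominus>\<^bsub>R\<^esub> group_element z)" for x
    by (auto simp: trivial_central_units_def R_def)
  show ?thesis
  proof (rule Z.subgroupI)
    show "trivial_central_units G \<noteq> {}"
      using C.one_closed T by blast
    fix x assume x: "x \<in> trivial_central_units G"
    then obtain z where z: "z \<in> center G" "x = group_element z \<or> x = \<ominus>\<^bsub>R\<^esub> group_element z"
      using T by blast
    then have zG: "z \<in> carrier G" by simp
    define y where "y = (if x = group_element z then group_element (inv\<^bsub>G\<^esub> z)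
                          else \<ominus>\<^bsub>R\<^esub> group_element (inv\<^bsub>G\<^esub> z))"
    have yT: "y \<in> trivial_central_units G"
      using C.m_inv_closed[OF z(1)] by (auto simp: T y_def)
    have "y \<otimes>\<^bsub>R\<^esub> x = \<one>\<^bsub>R\<^esub>"
      using inv[of "inv\<^bsub>G\<^esub> z"] z(2) zG clos[OF zG] clos[of "inv\<^bsub>G\<^esub> z"]
      by (auto simp: y_def R.l_minus R.r_minus)
    then have "inv\<^bsub>central_units G\<^esub> x = y"
      using sub x yT by (intro Z.inv_equality) (auto simp: multZ oneZ)
    then show "inv\<^bsub>central_units G\<^esub> x \<in> trivial_central_units G" using yT by simp
    fix x' assume "x' \<in> trivial_central_units G"
    then obtain w where w: "w \<in> center G" "x' = group_element w \<or> x' = \<ominus>\<^bsub>R\<^esub> group_element w"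
      using T by blast
    then have wG: "w \<in> carrier G" by simp
    have "x \<otimes>\<^bsub>R\<^esub> x' = group_element (z \<otimes>\<^bsub>G\<^esub> w) \<or> x \<otimes>\<^bsub>R\<^esub> x' = \<ominus>\<^bsub>R\<^esub> group_element (z \<otimes>\<^bsub>G\<^esub> w)"
      using z(2) w(2) clos[OF zG] clos[OF wG] prod[OF zG wG] R.m_closed[OF clos[OF zG] clos[OF wG]]
      by (auto simp: R.l_minus R.r_minus)
    then show "x \<otimes>\<^bsub>central_units G\<^esub> x' \<in> trivial_central_units G"
      using C.m_closed[OF z(1) w(1)] by (auto simp: multZ T)
  qed (use sub in auto)
qed

lemma complement_iso:
  assumes "group Z" and T: "subgroup T Z" and A: "subgroup A Z" and B: "subgroup B Z"
    and iA: "(\<lambda>(t, a). t \<otimes>\<^bsub>Z\<^esub> a) \<in> iso (Z\<lparr>carrier := T\<rparr> \<times>\<times> Z\<lparr>carrier := A\<rparr>) Z"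
    and iB: "(\<lambda>(t, a). t \<otimes>\<^bsub>Z\<^esub> a) \<in> iso (Z\<lparr>carrier := T\<rparr> \<times>\<times> Z\<lparr>carrier := B\<rparr>) Z"
  shows "Z\<lparr>carrier := A\<rparr> \<cong> Z\<lparr>carrier := B\<rparr>"
proof -
  interpret group Z by fact
  have AZ: "A \<subseteq> carrier Z" and BZ: "B \<subseteq> carrier Z"
    using subgroup.subset[OF A] subgroup.subset[OF B] by simp_all
  have oneA: "\<one>\<^bsub>Z\<^esub> \<in> A" and oneB: "\<one>\<^bsub>Z\<^esub> \<in> B"
    using subgroup.one_closed[OF A] subgroup.one_closed[OF B] by simp_all
  have bA: "bij_betw (\<lambda>(t, a). t \<otimes>\<^bsub>Z\<^esub> a) (T \<times> A) (carrier Z)"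
    using iA by (simp add: iso_def)
  have bB: "bij_betw (\<lambda>(t, a). t \<otimes>\<^bsub>Z\<^esub> a) (T \<times> B) (carrier Z)"
    using iB by (simp add: iso_def)
  have hB: "(t \<otimes>\<^bsub>Z\<^esub> t') \<otimes>\<^bsub>Z\<^esub> (b \<otimes>\<^bsub>Z\<^esub> b') = (t \<otimes>\<^bsub>Z\<^esub> b) \<otimes>\<^bsub>Z\<^esub> (t' \<otimes>\<^bsub>Z\<^esub> b')"
    if "t \<in> T" "t' \<in> T" "b \<in> B" "b' \<in> B" for t t' b b'
    using iB that by (auto simp: iso_def hom_def DirProd_def)
  have injA: "a = a'" if "t \<otimes>\<^bsub>Z\<^esub> a = t' \<otimes>\<^bsub>Z\<^esub> a'" "t \<in> T" "t' \<in> T" "a \<in> A" "a' \<in> A"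
    for t t' a a'
    using inj_onD[OF bij_betw_imp_inj_on[OF bA], of "(t, a)" "(t', a')"] that by auto
  have injB: "a = a'" if "t \<otimes>\<^bsub>Z\<^esub> a = t' \<otimes>\<^bsub>Z\<^esub> a'" "t \<in> T" "t' \<in> T" "a \<in> B" "a' \<in> B"
    for t t' a a'
    using inj_onD[OF bij_betw_imp_inj_on[OF bB], of "(t, a)" "(t', a')"] that by auto
  have exA: "\<exists>t\<in>T. \<exists>a\<in>A. z = t \<otimes>\<^bsub>Z\<^esub> a" if "z \<in> carrier Z" for z
    using bij_betw_imp_surj_on[OF bA] that by force
  have exB: "\<exists>t\<in>T. \<exists>a\<in>B. z = t \<otimes>\<^bsub>Z\<^esub> a" if "z \<in> carrier Z" for z
    using bij_betw_imp_surj_on[OF bB] that by force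
  interpret T: subgroup T Z by fact
  interpret A: subgroup A Z by fact
  interpret B: subgroup B Z by fact
  define p where "p a = (SOME b. b \<in> B \<and> (\<exists>t\<in>T. a = t \<otimes>\<^bsub>Z\<^esub> b))" for a
  have p: "p a \<in> B \<and> (\<exists>t\<in>T. a = t \<otimes>\<^bsub>Z\<^esub> p a)" if "a \<in> A" for a
    unfolding p_def by (rule someI_ex) (use exB[of a] that in auto)
  have p_eq: "p a = b" if "a \<in> A" "b \<in> B" "t \<in> T" "a = t \<otimes>\<^bsub>Z\<^esub> b" for a b t
    using p[OF that(1)] that injB by metis
  have "p (a \<otimes>\<^bsub>Z\<^esub> a') = p a \<otimes>\<^bsub>Z\<^esub> p a'" if aa: "a \<in> A" "a' \<in> A" for a a'
  proof -
    obtain t t' where t: "t \<in> T" "t' \<in> T" "a = t \<otimes>\<^bsub>Z\<^esub> p a" "a' = t' \<otimes>\<^bsub>Z\<^esub> p a'"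
      using p aa by metis
    have "a \<otimes>\<^bsub>Z\<^esub> a' = (t \<otimes>\<^bsub>Z\<^esub> t') \<otimes>\<^bsub>Z\<^esub> (p a \<otimes>\<^bsub>Z\<^esub> p a')"
      using hB[of t t' "p a" "p a'"] t p aa by metis
    moreover have "p a \<otimes>\<^bsub>Z\<^esub> p a' \<in> B"
      using B.m_closed conjunct1[OF p[OF aa(1)]] conjunct1[OF p[OF aa(2)]] .
    ultimately show ?thesis
      using p_eq A.m_closed[OF aa] T.m_closed[OF t(1,2)] by blast
  qed
  moreover have "inj_on p A"
  proof (rule inj_onI)
    fix a a' assume aa: "a \<in> A" "a' \<in> A" "p a = p a'"
    obtain t where t: "t \<in> T" "a = t \<otimes>\<^bsub>Z\<^esub> p a" using p[OF aa(1)] by blast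
    obtain t' where t': "t' \<in> T" "a' = t' \<otimes>\<^bsub>Z\<^esub> p a" using p[OF aa(2)] aa(3) by auto
    have pa: "p a \<in> carrier Z" using p[OF aa(1)] by auto
    have "inv\<^bsub>Z\<^esub> t \<otimes>\<^bsub>Z\<^esub> a = p a"
      using t(1) pa by (subst t(2)) (simp add: m_assoc[symmetric])
    moreover have "inv\<^bsub>Z\<^esub> t' \<otimes>\<^bsub>Z\<^esub> a' = p a"
      using t'(1) pa by (subst t'(2)) (simp add: m_assoc[symmetric])
    ultimately show "a = a'"
      using injA[of "inv\<^bsub>Z\<^esub> t" a "inv\<^bsub>Z\<^esub> t'" a'] t(1) t'(1) aa(1,2) by simp
  qed
  moreover have "p ` A = B"
  proof
    show "p ` A \<subseteq> B" using p by blast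
    show "B \<subseteq> p ` A"
    proof
      fix b assume b: "b \<in> B"
      obtain t a where t: "t \<in> T" "a \<in> A" "b = t \<otimes>\<^bsub>Z\<^esub> a" using exA[of b] b by auto
      have "a = inv\<^bsub>Z\<^esub> t \<otimes>\<^bsub>Z\<^esub> b"
        using t(1,2) unfolding t(3) by (simp add: m_assoc[symmetric])
      then have "p a = b" using p_eq[OF t(2) b T.m_inv_closed[OF t(1)]] by blast
      then show "b \<in> p ` A" using t(2) by blast
    qed
  qed
  ultimately have "p \<in> iso (Z\<lparr>carrier := A\<rparr>) (Z\<lparr>carrier := B\<rparr>)"
    by (auto simp: iso_def hom_def bij_betw_def)
  then show ?thesis by (auto simp: is_iso_def)
qed

lemma central_unit_rank_unique:
  assumes "group G" "finite (carrier G)" "central_unit_rank G r" "central_unit_rank G s"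
  shows "r = s"
proof -
  let ?Z = "central_units G"
  interpret Z: group ?Z using assms(1,2) by (rule group_central_units)
  obtain A where A: "subgroup A ?Z"
    "(\<lambda>(t, a). t \<otimes>\<^bsub>?Z\<^esub> a) \<in> iso (?Z\<lparr>carrier := trivial_central_units G\<rparr> \<times>\<times> ?Z\<lparr>carrier := A\<rparr>) ?Z"
    "?Z\<lparr>carrier := A\<rparr> \<cong> free_Abelian_group {..<r}"
    using assms(3) unfolding central_unit_rank_def by blast
  obtain B where B: "subgroup B ?Z"
    "(\<lambda>(t, a). t \<otimes>\<^bsub>?Z\<^esub> a) \<in> iso (?Z\<lparr>carrier := trivial_central_units G\<rparr> \<times>\<times> ?Z\<lparr>carrier := B\<rparr>) ?Z"
    "?Z\<lparr>carrier := B\<rparr> \<cong> free_Abelian_group {..<s}"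
    using assms(4) unfolding central_unit_rank_def by blast
  have "?Z\<lparr>carrier := A\<rparr> \<cong> ?Z\<lparr>carrier := B\<rparr>"
    using complement_iso[OF Z.is_group subgroup_trivial_central_units[OF assms(1,2)]] A B by blast
  moreover have "group (?Z\<lparr>carrier := A\<rparr>)" using A(1) by (rule Z.subgroup_imp_group)
  ultimately have "free_Abelian_group {..<r} \<cong> free_Abelian_group {..<s}"
    using A(3) B(3) by (meson group.iso_sym iso_trans)
  then show ?thesis
    by (simp add: isomorphic_free_Abelian_groups eqpoll_iff_card)
qed

end

(*
  A character of G extends to a ring homomorphism from ZG to the complex numbers.  By Parseval's
  identity a unit all of whose values have absolute value 1 is plus or minus a group element, and
  there are only finitely many units with a given bound on their values.  So everything is decided by
  the logarithms of the absolute values of units at characters.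

  For exponent dividing 4 or 6 the values lie in the Gaussian or Eisenstein integers and have absolute
  value 1.  For cyclic groups of order 5, 8 and 12 the squared absolute values at the remaining
  characters lie in a real quadratic order, and conjugate values are inverse to each other; so the
  logarithm at one character embeds the units modulo trivial units as a discrete subgroup of the reals.

  Conversely, if the rank is at most 1 then the logarithms at any two characters are proportional.
  Two Bass units violate this when G has an element of odd order at least 7.  If some t is in the kernel
  of one character of large order and not in that of another, a power of a Bass unit congruent to 1
  modulo the order of t can be changed into a unit of value 1 at all characters that do not kill t.
  Hence all characters of large order have the same kernel.  Twisting by further characters shows that
  this kernel is trivial, so that G is cyclic, and its order is then found among 5, 8 and 12.
*)

theory Submission
  imports Defs "HOL-Number_Theory.Residues"
begin

section \<open>Characters of finite abelian groups\<close>


lemma complex_root_exists: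
  fixes z :: complex
  assumes "m > 0"
  shows "\<exists>c. c ^ m = z"
proof
  show "(complex_of_real (root m (cmod z)) * cis (Arg z / m)) ^ m = z"
    using assms
    by (simp add: power_mult_distrib DeMoivre rcis_cmod_Arg[unfolded rcis_def] flip: of_real_power)
qed

locale finite_comm_group = comm_group G for G (structure) +
  assumes fin: "finite (carrier G)"
begin

definition character_on :: "'a set \<Rightarrow> ('a \<Rightarrow> complex) \<Rightarrow> bool" where
  "character_on H \<chi> \<longleftrightarrow> \<chi> \<one> = 1 \<and> (\<forall>x\<in>H. \<forall>y\<in>H. \<chi> (x \<otimes> y) = \<chi> x * \<chi> y)"

text \<open>The value 0 outside the group makes a character determined by its values on
  \<open>carrier G\<close>; hence \<open>characters\<close> is finite and sums over it count each
  character once.\<close>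

definition characters :: "('a \<Rightarrow> complex) set" where
  "characters = {\<chi>. character_on (carrier G) \<chi> \<and> (\<forall>x. x \<notin> carrier G \<longrightarrow> \<chi> x = 0)}"

lemma character_on_nonzero:
  assumes "subgroup H G" "character_on H \<chi>" "x \<in> H"
  shows "\<chi> x \<noteq> 0"
proof
  assume "\<chi> x = 0"
  moreover have "\<chi> x * \<chi> (inv x) = \<chi> (x \<otimes> inv x)"
    using assms by (simp add: character_on_def subgroup.m_inv_closed)
  ultimately show False
    using assms by (simp add: character_on_def subgroup.mem_carrier)
qed

lemma character_on_pow:
  assumes "subgroup H G" "character_on H \<chi>" "x \<in> H"
  shows "\<chi> (x [^] (n::nat)) = \<chi> x ^ n"
proof (induction n)
  case (Suc n)
  have "x [^] n \<in> H" using assms(1,3) by (induction n) (auto simp: subgroup.one_closed subgroup.m_closed)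
  then show ?case using Suc assms by (simp add: character_on_def)
qed (use assms in \<open>simp add: character_on_def\<close>)

text \<open>\<open>m\<close> is the order of \<open>h\<close> modulo \<open>H\<close>. A value
  \<open>c\<close> at \<open>h\<close> has to satisfy \<open>c ^ m = \<chi> (h [^] m)\<close>, and
  this is the only obstruction to an extension. The root \<open>c\<close> is left to the caller so
  that the value at \<open>h\<close> can be prescribed.\<close>

lemma character_extend_step:
  assumes H: "subgroup H G" and \<chi>: "character_on H \<chi>" and h: "h \<in> carrier G"
    and m: "\<And>i::nat. h [^] i \<in> H \<longleftrightarrow> m dvd i" and m0: "m > 0" and c: "c ^ m = \<chi> (h [^] m)"
  shows "\<exists>H' \<chi>'. subgroup H' G \<and> character_on H' \<chi>' \<and> H \<subseteq> H' \<and> h \<in> H' \<and>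
           (\<forall>x\<in>H. \<chi>' x = \<chi> x) \<and> \<chi>' h = c"
proof -
  interpret H: subgroup H G by (rule H)
  \<comment> \<open>Since \<open>h\<close> has finite order modulo \<open>H\<close>,
    \<open>H'\<close> is the subgroup generated by \<open>H\<close> and \<open>h\<close> although
    only natural exponents occur. Multiplicativity forces the formula for
    \<open>\<chi>'\<close>.\<close>
  define H' where "H' = {z \<in> carrier G. \<exists>i::nat. z \<otimes> h [^] i \<in> H}"
  define \<chi>' where "\<chi>' z = (let i = SOME i::nat. z \<otimes> h [^] i \<in> H in \<chi> (z \<otimes> h [^] i) / c ^ i)" for z
  have mult: "\<chi> (x \<otimes> y) = \<chi> x * \<chi> y" if "x \<in> H" "y \<in> H" for x y
    using \<chi> that by (simp add: character_on_def)
  have c0: "c \<noteq> 0"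
    using character_on_nonzero[OF H \<chi>, of "h [^] m"] c m[of m] m0 by (auto simp: power_0_left)
  \<comment> \<open>The quotient does not depend on the exponent: two admissible exponents differ by
    a multiple of \<open>m\<close>, and \<open>c ^ m\<close> is the value at
    \<open>h [^] m\<close>.\<close>
  have le: "\<chi> (z \<otimes> h [^] i) / c ^ i = \<chi> (z \<otimes> h [^] j) / c ^ j"
    if z: "z \<in> carrier G" and i: "z \<otimes> h [^] i \<in> H" and j: "z \<otimes> h [^] j \<in> H" and ij: "i \<le> j"
    for z and i j :: nat
  proof -
    have eq: "z \<otimes> h [^] j = (z \<otimes> h [^] i) \<otimes> h [^] (j - i)"
      using z h ij by (simp add: m_assoc nat_pow_mult)
    have "h [^] (j - i) = inv (z \<otimes> h [^] i) \<otimes> (z \<otimes> h [^] j)"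
      using eq z h inv_solve_left[of "h [^] (j - i)" "z \<otimes> h [^] i" "z \<otimes> h [^] j"] by simp
    then have hji: "h [^] (j - i) \<in> H" using i j by (simp del: inv_mult_group)
    then obtain k where k: "j - i = m * k" using m by (auto simp: dvd_def)
    have hm: "h [^] m \<in> H" using m by simp
    have "\<chi> (h [^] (j - i)) = c ^ (j - i)"
      unfolding k using character_on_pow[OF H \<chi> hm, of k] c h by (simp add: nat_pow_pow power_mult)
    then have "\<chi> (z \<otimes> h [^] j) = \<chi> (z \<otimes> h [^] i) * c ^ (j - i)"
      unfolding eq using mult[OF i hji] by simp
    moreover have "c ^ j = c ^ i * c ^ (j - i)" using ij by (simp flip: power_add)
    ultimately show ?thesis using c0 by simp
  qed
  have val: "\<chi>' z = \<chi> (z \<otimes> h [^] i) / c ^ i" if "z \<in> carrier G" "z \<otimes> h [^] i \<in> H" for z and i :: nat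
  proof -
    define j where "j = (SOME i::nat. z \<otimes> h [^] i \<in> H)"
    have "z \<otimes> h [^] j \<in> H" unfolding j_def using that(2) by (rule someI)
    then have "\<chi> (z \<otimes> h [^] j) / c ^ j = \<chi> (z \<otimes> h [^] i) / c ^ i"
      using le that by (metis nat_le_linear)
    then show ?thesis by (simp add: \<chi>'_def j_def Let_def)
  qed
  have prod: "(x \<otimes> y) \<otimes> h [^] (i + j) = (x \<otimes> h [^] i) \<otimes> (y \<otimes> h [^] j)"
    if "x \<in> carrier G" "y \<in> carrier G" for x y and i j :: nat
    using that h by (simp add: nat_pow_mult[symmetric] m_ac)
  have "subgroup H' G"
  proof (rule subgroupI)
    show "H' \<noteq> {}" using H.one_closed by (auto simp: H'_def intro!: exI[of _ "\<one>"] exI[of _ 0])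
    fix a assume "a \<in> H'"
    then obtain i :: nat where a: "a \<in> carrier G" "a \<otimes> h [^] i \<in> H" by (auto simp: H'_def)
    \<comment> \<open>The inverse needs the exponent \<open>-i\<close>, which is replaced by
      \<open>m * i - i\<close>; as \<open>m > 0\<close>, this subtraction is not truncated.\<close>
    obtain k where k: "m * k = i + (m * i - i)" using m0 by (metis le_add_diff_inverse mult_le_mono1 nat_mult_1 Suc_leI One_nat_def)
    have "inv a \<otimes> h [^] (m * i - i) = inv (a \<otimes> h [^] i) \<otimes> h [^] (m * k)"
      unfolding k using a h by (simp add: inv_mult m_ac nat_pow_mult[symmetric] r_inv_ex) (simp add: m_assoc[symmetric])
    then have "inv a \<otimes> h [^] (m * i - i) \<in> H" using a m[of "m * k"] by (simp del: inv_mult_group)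
    then show "inv a \<in> H'" using a by (auto simp: H'_def)
    fix b assume "b \<in> H'"
    then obtain j :: nat where b: "b \<in> carrier G" "b \<otimes> h [^] j \<in> H" by (auto simp: H'_def)
    have "(a \<otimes> b) \<otimes> h [^] (i + j) \<in> H" using a b prod by simp
    then show "a \<otimes> b \<in> H'" using a b by (auto simp: H'_def)
  qed (auto simp: H'_def)
  moreover have "character_on H' \<chi>'"
    unfolding character_on_def
  proof (intro conjI ballI)
    show "\<chi>' \<one> = 1" using val[of "\<one>" 0] \<chi> by (simp add: character_on_def)
    fix x y assume "x \<in> H'" "y \<in> H'"
    then obtain i j :: nat where x: "x \<in> carrier G" "x \<otimes> h [^] i \<in> H"
      and y: "y \<in> carrier G" "y \<otimes> h [^] j \<in> H" by (auto simp: H'_def)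
    show "\<chi>' (x \<otimes> y) = \<chi>' x * \<chi>' y"
      using val[of "x \<otimes> y" "i + j"] val[OF x] val[OF y] x y prod[OF x(1) y(1), of i j]
      by (simp add: mult power_add)
  qed
  moreover have "H \<subseteq> H'" by (auto simp: H'_def intro!: exI[of _ 0])
  moreover have "\<chi>' x = \<chi> x" if "x \<in> H" for x using val[of x 0] that by simp
  \<comment> \<open>The exponent \<open>m - 1\<close> shows both that \<open>h\<close> lies in
    \<open>H'\<close> and that
    \<open>\<chi>' h = \<chi> (h [^] m) / c ^ (m - 1) = c\<close>.\<close>
  moreover have "h \<otimes> h [^] (m - 1) = h [^] m" using h m0 by (simp add: nat_pow_Suc2[symmetric])
  moreover from this have "h \<in> H'" using h m[of m] unfolding H'_def by (metis (mono_tags, lifting) dvd_refl mem_Collect_eq)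
  moreover have "\<chi>' h = c"
  proof -
    have "c ^ m = c * c ^ (m - 1)" using m0 by (simp flip: power_Suc)
    then show ?thesis
      using val[OF h, of "m - 1"] \<open>h \<otimes> h [^] (m - 1) = h [^] m\<close> m[of m] c0 by (simp flip: c)
  qed
  ultimately show ?thesis by blast
qed

text \<open>Elements outside \<open>H\<close> are adjoined one at a time; a suitable
  \<open>c\<close> exists because every complex number has an \<open>m\<close>-th root. The
  induction is on the number of elements of \<open>G\<close> still missing.\<close>

lemma character_extend:
  assumes "subgroup H G" "character_on H \<chi>"
  shows "\<exists>\<psi>\<in>characters. \<forall>x\<in>H. \<psi> x = \<chi> x"
  using assms
proof (induction "card (carrier G) - card H" arbitrary: H \<chi> rule: less_induct)
  case less
  interpret H: subgroup H G by (rule less.prems)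
  show ?case
  proof (cases "H = carrier G")
    case True
    then show ?thesis
      using less.prems
      by (intro bexI[of _ "\<lambda>x. if x \<in> carrier G then \<chi> x else 0"])
        (auto simp: characters_def character_on_def)
  next
    case False
    then obtain h where h: "h \<in> carrier G" "h \<notin> H" using H.subset by blast
    define m where "m = (LEAST m::nat. 0 < m \<and> h [^] m \<in> H)"
    have ex: "0 < order G \<and> h [^] order G \<in> H"
      using h pow_order_eq_1[OF h(1)] fin by (simp add: order_gt_0_iff_finite)
    have m: "0 < m \<and> h [^] m \<in> H" unfolding m_def using ex by (rule LeastI)
    have pw: "h [^] (m * k) \<in> H" for k :: nat
    proof (induction k)
      case (Suc k)
      have "h [^] (m * Suc k) = h [^] m \<otimes> h [^] (m * k)" using h by (simp add: nat_pow_mult)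
      then show ?case using Suc m by simp
    qed simp
    have iff: "h [^] i \<in> H \<longleftrightarrow> m dvd i" for i :: nat
    proof
      assume i: "h [^] i \<in> H"
      have eq: "h [^] i = h [^] (m * (i div m)) \<otimes> h [^] (i mod m)" using h by (simp add: nat_pow_mult)
      have "h [^] (i mod m) = inv (h [^] (m * (i div m))) \<otimes> h [^] i"
        unfolding eq using h by (simp add: m_assoc[symmetric])
      then have "h [^] (i mod m) \<in> H" using i pw by simp
      then have "\<not> 0 < i mod m"
        using m not_less_Least[of "i mod m" "\<lambda>m. 0 < m \<and> h [^] m \<in> H"] by (auto simp: m_def[symmetric])
      then show "m dvd i" by auto
    qed (use pw in \<open>auto simp: dvd_def\<close>)
    obtain c where c: "c ^ m = \<chi> (h [^] m)" using complex_root_exists m by blast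
    obtain H' \<chi>' where H': "subgroup H' G" "character_on H' \<chi>'" "H \<subseteq> H'" "h \<in> H'"
      "\<forall>x\<in>H. \<chi>' x = \<chi> x"
      using character_extend_step[OF less.prems h(1) iff _ c] m by blast
    have "H \<subset> H'" using H' h by blast
    moreover have "H' \<subseteq> carrier G" using subgroup.subset[OF H'(1)] .
    ultimately have "card (carrier G) - card H' < card (carrier G) - card H"
      using fin by (intro diff_less_mono2 psubset_card_mono) (auto intro: finite_subset less_le_trans[OF psubset_card_mono card_mono])
    then obtain \<psi> where "\<psi> \<in> characters" "\<forall>x\<in>H'. \<psi> x = \<chi>' x"
      using less.hyps[OF _ H'(1,2)] by blast
    then have "\<forall>x\<in>H. \<psi> x = \<chi> x" using H'(3,5) by (metis subsetD)
    then show ?thesis using \<open>\<psi> \<in> characters\<close> by (intro bexI[of _ \<psi>])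
  qed
qed

text \<open>Extend from the trivial subgroup, where \<open>m\<close> is the order of
  \<open>h\<close> and \<open>c\<close> a primitive root of unity of that order. The resulting
  character is faithful on the powers of \<open>h\<close>.\<close>

lemma character_exists:
  assumes h: "h \<in> carrier G"
  shows "\<exists>\<chi>\<in>characters. \<chi> h = cis (2 * pi / ord h)"
proof -
  have o: "ord h > 0" using ord_ge_1[OF fin h] by simp
  have t: "subgroup {\<one>} G" by (rule triv_subgroup)
  obtain H' \<chi>' where H': "subgroup H' G" "character_on H' \<chi>'" "h \<in> H'" "\<chi>' h = cis (2 * pi / ord h)"
    using character_extend_step[of "{\<one>}" "\<lambda>_. 1" h "ord h" "cis (2 * pi / ord h)"]
      t h o pow_eq_id[OF h] by (auto simp: character_on_def DeMoivre)
  then show ?thesis using character_extend[OF H'(1,2)] by fastforce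
qed

section \<open>Values of characters, separation of elements and orthogonality\<close>

lemma char_one: "\<chi> \<in> characters \<Longrightarrow> \<chi> \<one> = 1"
  and char_mult: "\<lbrakk>\<chi> \<in> characters; x \<in> carrier G; y \<in> carrier G\<rbrakk> \<Longrightarrow> \<chi> (x \<otimes> y) = \<chi> x * \<chi> y"
  and char_outside: "\<lbrakk>\<chi> \<in> characters; x \<notin> carrier G\<rbrakk> \<Longrightarrow> \<chi> x = 0"
  by (auto simp: characters_def character_on_def)

lemma char_pow: "\<lbrakk>\<chi> \<in> characters; x \<in> carrier G\<rbrakk> \<Longrightarrow> \<chi> (x [^] (n::nat)) = \<chi> x ^ n"
  by (rule character_on_pow[OF subgroup_self]) (auto simp: characters_def)

lemma char_pow_ord: "\<lbrakk>\<chi> \<in> characters; x \<in> carrier G\<rbrakk> \<Longrightarrow> \<chi> x ^ ord x = 1"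
  by (metis char_one char_pow pow_ord_eq_1)

lemma cmod_char: "\<lbrakk>\<chi> \<in> characters; x \<in> carrier G\<rbrakk> \<Longrightarrow> cmod (\<chi> x) = 1"
  using char_pow_ord[of \<chi> x] ord_ge_1[OF fin, of x]
  by (metis norm_ge_zero norm_one norm_power power_eq_1_iff not_one_le_zero abs_norm_cancel power_eq_imp_eq_base zero_less_one le_eq_less_or_eq power_one zero_le_one)

lemma char_nonzero: "\<lbrakk>\<chi> \<in> characters; x \<in> carrier G\<rbrakk> \<Longrightarrow> \<chi> x \<noteq> 0"
  using cmod_char by fastforce

lemma char_inv: "\<lbrakk>\<chi> \<in> characters; x \<in> carrier G\<rbrakk> \<Longrightarrow> \<chi> (inv x) = cnj (\<chi> x)"
proof -
  assume a: "\<chi> \<in> characters" "x \<in> carrier G"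
  have "\<chi> x * \<chi> (inv x) = 1" using a char_mult[of \<chi> x "inv x"] char_one[of \<chi>] by (simp del: char_one)
  moreover have "\<chi> x * cnj (\<chi> x) = 1" using cmod_char[OF a] by (simp add: complex_norm_square[symmetric])
  ultimately show ?thesis using char_nonzero[OF a] by (metis mult_left_cancel)
qed

lemma char_times: "\<lbrakk>\<chi> \<in> characters; \<psi> \<in> characters\<rbrakk> \<Longrightarrow> (\<lambda>x. \<chi> x * \<psi> x) \<in> characters"
  by (auto simp: characters_def character_on_def)

lemma char_power: "\<chi> \<in> characters \<Longrightarrow> (\<lambda>x. if x \<in> carrier G then \<chi> x ^ n else 0) \<in> characters"
  by (auto simp: characters_def character_on_def power_mult_distrib)

lemma char_cnj: "\<chi> \<in> characters \<Longrightarrow> (\<lambda>x. cnj (\<chi> x)) \<in> characters"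
  by (auto simp: characters_def character_on_def)

lemma char_trivial: "(\<lambda>x. if x \<in> carrier G then 1 else 0) \<in> characters"
  by (auto simp: characters_def character_on_def)

lemma char_separates:
  assumes "x \<in> carrier G" "x \<noteq> \<one>"
  shows "\<exists>\<chi>\<in>characters. \<chi> x \<noteq> 1"
proof -
  obtain \<chi> where \<chi>: "\<chi> \<in> characters" "\<chi> x = cis (2 * pi / ord x)"
    using character_exists assms(1) by blast
  have n: "ord x > 1" using assms ord_ge_1[OF fin, of x] ord_eq_1[of x] by linarith
  have "cis (2 * pi / ord x) \<noteq> 1"
  proof
    assume "cis (2 * pi / ord x) = 1"
    then have "cos (2 * pi / ord x) = cos 0" by (simp add: complex_eq_iff)
    moreover have "2 * pi / ord x \<le> pi" "0 < 2 * pi / ord x" using n by (simp_all add: field_simps)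
    ultimately show False using cos_monotone_0_pi[of 0 "2 * pi / ord x"] by linarith
  qed
  then show ?thesis using \<chi> by (metis (no_types))
qed

lemma finite_characters: "finite characters"
proof -
  have "characters \<subseteq> {f. \<forall>x. (x \<in> carrier G \<longrightarrow> f x \<in> {z. z ^ order G = 1}) \<and> (x \<notin> carrier G \<longrightarrow> f x = 0)}"
    using char_outside by (auto simp: char_pow[symmetric] pow_order_eq_1 char_one)
  moreover have roots: "finite {z::complex. z ^ order G = 1}"
    using fin by (intro finite_roots_unity) (simp add: Suc_leI order_gt_0_iff_finite)
  ultimately show ?thesis
    using finite_subset finite_set_of_finite_funs[OF fin roots] by fast
qed

lemma card_characters_pos: "card characters > 0"
  using finite_characters char_trivial by (auto simp: card_gt_0_iff)

text \<open>Multiplication by a character \<open>\<theta>\<close> with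
  \<open>\<theta> x \<noteq> 1\<close> permutes the characters, so for
  \<open>x \<noteq> \<one>\<close> the sum equals \<open>\<theta> x\<close> times itself.\<close>

lemma sum_characters:
  assumes x: "x \<in> carrier G"
  shows "(\<Sum>\<chi>\<in>characters. \<chi> x) = (if x = \<one> then of_nat (card characters) else 0)"
proof (cases "x = \<one>")
  case False
  then obtain \<theta> where \<theta>: "\<theta> \<in> characters" "\<theta> x \<noteq> 1" using char_separates x by blast
  have unit: "\<theta> y * cnj (\<theta> y) = 1" if "y \<in> carrier G" for y
    using cmod_char[OF \<theta>(1) that] by (simp add: complex_norm_square[symmetric])
  have "(\<lambda>y. \<theta> y * (cnj (\<theta> y) * \<chi> y)) = \<chi>" "(\<lambda>y. cnj (\<theta> y) * (\<theta> y * \<chi> y)) = \<chi>" if "\<chi> \<in> characters" for \<chi>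
    using unit char_outside[OF that]
    by (auto simp: fun_eq_iff mult.assoc[symmetric] mult.commute[of "cnj _"])
  then have "(\<Sum>\<chi>\<in>characters. \<chi> x) = (\<Sum>\<chi>\<in>characters. \<theta> x * \<chi> x)"
    by (intro sum.reindex_bij_witness[where i = "\<lambda>\<chi> y. \<theta> y * \<chi> y" and j = "\<lambda>\<chi> y. cnj (\<theta> y) * \<chi> y"])
      (use \<theta> in \<open>auto simp: unit[OF x] mult.assoc[symmetric] intro: char_times[OF \<theta>(1)] char_times[OF char_cnj[OF \<theta>(1)]] dest: fun_cong\<close>)
  then have "(\<theta> x - 1) * (\<Sum>\<chi>\<in>characters. \<chi> x) = 0"
    by (simp add: sum_distrib_left[symmetric] left_diff_distrib)
  then show ?thesis using \<theta> False by simp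
qed (simp add: char_one)

end

section \<open>Evaluation of the integral group ring at characters\<close>


context finite_comm_group
begin

abbreviation ZG :: "('a \<Rightarrow> int) ring" where
  "ZG \<equiv> integral_group_ring G"

definition ev :: "('a \<Rightarrow> complex) \<Rightarrow> ('a \<Rightarrow> int) \<Rightarrow> complex" where
  "ev \<chi> f = (\<Sum>x\<in>carrier G. of_int (f x) * \<chi> x)"

lemma carrier_ZG: "f \<in> carrier ZG \<longleftrightarrow> (\<forall>x. x \<notin> carrier G \<longrightarrow> f x = 0)"
  by (simp add: integral_group_ring_def)

lemma ev_add: "ev \<chi> (f \<oplus>\<^bsub>ZG\<^esub> g) = ev \<chi> f + ev \<chi> g"
  by (simp add: ev_def integral_group_ring_def sum.distrib distrib_right)

lemma ev_one: "\<chi> \<in> characters \<Longrightarrow> ev \<chi> \<one>\<^bsub>ZG\<^esub> = 1"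
  using fin by (simp add: ev_def integral_group_ring_def char_one if_distrib[of of_int]
      if_distrib[of "\<lambda>y. y * _"] sum.delta cong: if_cong)

lemma ev_group_element: "g \<in> carrier G \<Longrightarrow> ev \<chi> (group_element g) = \<chi> g"
  using fin by (simp add: ev_def group_element_def if_distrib[of of_int]
      if_distrib[of "\<lambda>y. y * _"] sum.delta cong: if_cong)

lemma ev_scale: "ev \<chi> (\<lambda>x. k * f x) = of_int k * ev \<chi> f"
  by (simp add: ev_def sum_distrib_left mult.assoc)

lemma ev_uminus: "ev \<chi> (\<lambda>x. - f x) = - ev \<chi> f"
  by (simp add: ev_def sum_negf)

lemma ev_mult:
  assumes "\<chi> \<in> characters"
  shows "ev \<chi> (f \<otimes>\<^bsub>ZG\<^esub> g) = ev \<chi> f * ev \<chi> g"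
proof -
  have inner: "(\<Sum>z\<in>carrier G. of_int (g (inv x \<otimes> z)) * \<chi> z) = \<chi> x * ev \<chi> g"
    if x: "x \<in> carrier G" for x
  proof -
    have can: "x \<otimes> (inv x \<otimes> z) = z" "inv x \<otimes> (x \<otimes> z) = z" if "z \<in> carrier G" for z
      using x that by (simp_all add: m_assoc[symmetric])
    have "(\<Sum>z\<in>carrier G. of_int (g (inv x \<otimes> z)) * \<chi> z) = (\<Sum>w\<in>carrier G. of_int (g w) * \<chi> (x \<otimes> w))"
      by (rule sum.reindex_bij_witness[of _ "\<lambda>w. x \<otimes> w" "\<lambda>z. inv x \<otimes> z"]) (use x can in simp_all)
    then show ?thesis
      using x assms by (simp add: ev_def sum_distrib_left char_mult mult_ac)
  qed
  have "ev \<chi> (f \<otimes>\<^bsub>ZG\<^esub> g) = (\<Sum>z\<in>carrier G. \<Sum>x\<in>carrier G. of_int (f x) * (of_int (g (inv x \<otimes> z)) * \<chi> z))"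
    by (simp add: ev_def integral_group_ring_def sum_distrib_right mult.assoc)
  also have "\<dots> = (\<Sum>x\<in>carrier G. of_int (f x) * (\<Sum>z\<in>carrier G. of_int (g (inv x \<otimes> z)) * \<chi> z))"
    by (subst sum.swap) (simp add: sum_distrib_left)
  also have "\<dots> = ev \<chi> f * ev \<chi> g"
    by (simp add: inner ev_def[of \<chi> f] sum_distrib_right mult.assoc)
  finally show ?thesis .
qed

text \<open>Expanding the square gives terms \<open>f x * f y * \<chi> (x \<otimes> inv y)\<close>,
  and by orthogonality the sum over all characters leaves only \<open>y = x\<close>.\<close>

lemma parseval:
  "(\<Sum>\<chi>\<in>characters. (cmod (ev \<chi> f))\<^sup>2) = real (card characters) * (\<Sum>x\<in>carrier G. (real_of_int (f x))\<^sup>2)"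
proof -
  have "(\<Sum>\<chi>\<in>characters. complex_of_real ((cmod (ev \<chi> f))\<^sup>2)) =
      (\<Sum>\<chi>\<in>characters. \<Sum>x\<in>carrier G. \<Sum>y\<in>carrier G. of_int (f x) * of_int (f y) * \<chi> (x \<otimes> inv y))"
  proof (rule sum.cong[OF refl])
    fix \<chi> assume \<chi>: "\<chi> \<in> characters"
    have "complex_of_real ((cmod (ev \<chi> f))\<^sup>2) = ev \<chi> f * cnj (ev \<chi> f)"
      by (rule complex_norm_square)
    also have "\<dots> = (\<Sum>x\<in>carrier G. \<Sum>y\<in>carrier G. (of_int (f x) * \<chi> x) * (of_int (f y) * cnj (\<chi> y)))"
      by (simp add: ev_def sum_product)
    also have "\<dots> = (\<Sum>x\<in>carrier G. \<Sum>y\<in>carrier G. of_int (f x) * of_int (f y) * \<chi> (x \<otimes> inv y))"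
      using \<chi> by (intro sum.cong refl) (simp add: char_mult char_inv mult_ac)
    finally show "complex_of_real ((cmod (ev \<chi> f))\<^sup>2) = \<dots>" .
  qed
  also have "\<dots> = (\<Sum>x\<in>carrier G. \<Sum>y\<in>carrier G. of_int (f x) * of_int (f y) * (\<Sum>\<chi>\<in>characters. \<chi> (x \<otimes> inv y)))"
    by (subst sum.swap, intro sum.cong refl, subst sum.swap) (simp add: sum_distrib_left)
  also have "\<dots> = (\<Sum>x\<in>carrier G. \<Sum>y\<in>carrier G. if y = x then of_int (f x) * of_int (f x) * of_nat (card characters) else 0)"
  proof (intro sum.cong refl)
    fix x y assume xy: "x \<in> carrier G" "y \<in> carrier G"
    have "x \<otimes> inv y = \<one> \<longleftrightarrow> y = x" using xy by (metis inv_closed inv_equality inv_inv r_inv)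
    then show "of_int (f x) * of_int (f y) * (\<Sum>\<chi>\<in>characters. \<chi> (x \<otimes> inv y)) =
        (if y = x then of_int (f x) * of_int (f x) * of_nat (card characters) else (0::complex))"
      using xy by (simp add: sum_characters)
  qed
  also have "\<dots> = complex_of_real (real (card characters) * (\<Sum>x\<in>carrier G. (real_of_int (f x))\<^sup>2))"
    using fin by (simp add: sum.delta sum_distrib_left power2_eq_square mult_ac)
  finally show ?thesis
    by (metis (mono_tags, lifting) of_real_eq_iff of_real_sum sum.cong)
qed

text \<open>Parseval applied to the difference makes all its coefficients vanish. Identities in
  \<open>ZG\<close> can from here on be verified one character at a time.\<close>

lemma ev_inject:
  assumes f: "f \<in> carrier ZG" and g: "g \<in> carrier ZG"
    and eq: "\<And>\<chi>. \<chi> \<in> characters \<Longrightarrow> ev \<chi> f = ev \<chi> g"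
  shows "f = g"
proof
  fix x
  have "ev \<chi> (\<lambda>x. f x - g x) = 0" if "\<chi> \<in> characters" for \<chi>
    using eq[OF that] by (simp add: ev_def left_diff_distrib sum_subtractf)
  then have "(\<Sum>x\<in>carrier G. (real_of_int (f x - g x))\<^sup>2) = 0"
    using parseval[of "\<lambda>x. f x - g x"] card_characters_pos by simp
  then have "f x = g x" if "x \<in> carrier G"
    using fin that by (subst (asm) sum_nonneg_eq_0_iff) auto
  then show "f x = g x" using f g by (cases "x \<in> carrier G") (simp_all add: carrier_ZG)
qed

section \<open>Units of the commutative ring \<open>ZG\<close> and their logarithms\<close>

lemma ring_ZG: "ring ZG"
  by (rule ring_integral_group_ring[OF is_group fin])

text \<open>Commutativity is inherited from the complex numbers through
  \<open>ev_inject\<close>.\<close>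

lemma cring_ZG: "cring ZG"
proof -
  interpret R: ring ZG by (rule ring_ZG)
  have "x \<otimes>\<^bsub>ZG\<^esub> y = y \<otimes>\<^bsub>ZG\<^esub> x" if "x \<in> carrier ZG" "y \<in> carrier ZG" for x y
    using that by (intro ev_inject) (auto simp: ev_mult)
  then show ?thesis
    by (intro cring.intro comm_monoid.intro comm_monoid_axioms.intro ring_ZG R.monoid_axioms)
qed

sublocale ZG: cring ZG by (rule cring_ZG)

lemma group_element_closed: "g \<in> carrier G \<Longrightarrow> group_element g \<in> carrier ZG"
  by (auto simp: carrier_ZG group_element_def)

lemma ev_minus:
  assumes "\<chi> \<in> characters" "f \<in> carrier ZG"
  shows "ev \<chi> (\<ominus>\<^bsub>ZG\<^esub> f) = - ev \<chi> f"
proof -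
  have "ev \<chi> (f \<oplus>\<^bsub>ZG\<^esub> \<ominus>\<^bsub>ZG\<^esub> f) = 0"
    using assms(2) by (simp add: ZG.r_neg) (simp add: ev_def integral_group_ring_def)
  then show ?thesis by (simp add: ev_add add_eq_0_iff)
qed

lemma central_units_eq: "central_units G = units_of ZG"
proof -
  have "center (units_of ZG) = Units ZG"
    by (auto simp: center_def units_of_def ZG.m_comm ZG.Units_closed)
  then show ?thesis by (simp add: central_units_def units_of_def)
qed

lemma center_eq: "center G = carrier G"
  by (auto simp: center_def m_comm)

lemma comm_group_units: "comm_group (units_of ZG)"
  by (rule ZG.units_comm_group)

lemma unitI:
  assumes "f \<in> carrier ZG" "g \<in> carrier ZG" "\<And>\<chi>. \<chi> \<in> characters \<Longrightarrow> ev \<chi> f * ev \<chi> g = 1"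
  shows "f \<in> Units ZG"
proof -
  have "f \<otimes>\<^bsub>ZG\<^esub> g = \<one>\<^bsub>ZG\<^esub>"
    using assms by (intro ev_inject) (auto simp: ev_mult ev_one)
  then show ?thesis using assms(1,2) by (auto simp: Units_def ZG.m_comm[of _ f] intro!: bexI[of _ g])
qed

lemma ev_unit_inverse:
  assumes "\<chi> \<in> characters" "u \<in> Units ZG"
  shows "ev \<chi> u * ev \<chi> (inv\<^bsub>ZG\<^esub> u) = 1"
  using assms by (simp add: ev_mult[symmetric] ev_one)

lemma ev_unit_nonzero: "\<lbrakk>\<chi> \<in> characters; u \<in> Units ZG\<rbrakk> \<Longrightarrow> ev \<chi> u \<noteq> 0"
  by (metis ev_unit_inverse mult_zero_left zero_neq_one)

text \<open>A coordinate of the logarithmic embedding of Dirichlet's unit theorem.\<close>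

definition log_ev :: "('a \<Rightarrow> complex) \<Rightarrow> ('a \<Rightarrow> int) \<Rightarrow> real" where
  "log_ev \<chi> u = ln (cmod (ev \<chi> u))"

lemma log_ev_mult:
  "\<lbrakk>\<chi> \<in> characters; u \<in> Units ZG; v \<in> Units ZG\<rbrakk> \<Longrightarrow> log_ev \<chi> (u \<otimes>\<^bsub>ZG\<^esub> v) = log_ev \<chi> u + log_ev \<chi> v"
  by (simp add: log_ev_def ev_mult norm_mult ln_mult ev_unit_nonzero)

lemma log_ev_one: "\<chi> \<in> characters \<Longrightarrow> log_ev \<chi> \<one>\<^bsub>ZG\<^esub> = 0"
  by (simp add: log_ev_def ev_one)

lemma log_ev_inv:
  assumes "\<chi> \<in> characters" "u \<in> Units ZG"
  shows "log_ev \<chi> (inv\<^bsub>ZG\<^esub> u) = - log_ev \<chi> u"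
  using log_ev_mult[OF assms ZG.Units_inv_Units[OF assms(2)]] log_ev_one[OF assms(1)] assms
  by simp

lemma log_ev_eq_0_iff:
  "\<lbrakk>\<chi> \<in> characters; u \<in> Units ZG\<rbrakk> \<Longrightarrow> log_ev \<chi> u = 0 \<longleftrightarrow> cmod (ev \<chi> u) = 1"
  using ev_unit_nonzero[of \<chi> u] by (simp add: log_ev_def)

lemma trivial_units_subset: "trivial_central_units G \<subseteq> Units ZG"
  using subgroup.subset[OF subgroup_trivial_central_units[OF is_group fin]]
  by (simp add: central_units_eq units_of_def)

lemma log_ev_trivial:
  assumes "\<chi> \<in> characters" "t \<in> trivial_central_units G"
  shows "log_ev \<chi> t = 0"
  using assms by (auto simp: trivial_central_units_def center_eq log_ev_def ev_minus
      group_element_closed ev_group_element cmod_char)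

text \<open>This determines the kernel of the logarithmic embedding. All values have absolute value
  1, so by Parseval the squared integer coefficients add up to 1 and exactly one coefficient is
  nonzero.\<close>

lemma trivial_unitI:
  assumes u: "u \<in> Units ZG" and 1: "\<And>\<chi>. \<chi> \<in> characters \<Longrightarrow> log_ev \<chi> u = 0"
  shows "u \<in> trivial_central_units G"
proof -
  have uc: "u \<in> carrier ZG" using u by (rule ZG.Units_closed)
  have "real (card characters) * (\<Sum>x\<in>carrier G. (real_of_int (u x))\<^sup>2) = real (card characters)"
    using log_ev_eq_0_iff u 1 by (simp flip: parseval)
  then have "(\<Sum>x\<in>carrier G. (real_of_int (u x))\<^sup>2) = 1"
    using card_characters_pos by simp
  then have "real_of_int (\<Sum>x\<in>carrier G. (u x)\<^sup>2) = 1" by simp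
  then have sum1: "(\<Sum>x\<in>carrier G. (u x)\<^sup>2) = 1" by linarith
  then obtain g where g: "g \<in> carrier G" "u g \<noteq> 0"
    by (metis (no_types, lifting) sum.neutral zero_eq_power2 zero_neq_one)
  have split: "(\<Sum>x\<in>carrier G. (u x)\<^sup>2) = (u g)\<^sup>2 + (\<Sum>x\<in>carrier G - {g}. (u x)\<^sup>2)"
    using fin g(1) by (simp add: sum.remove)
  have "(u g)\<^sup>2 \<ge> 1" using g(2) by (simp add: int_one_le_iff_zero_less)
  moreover have "(\<Sum>x\<in>carrier G - {g}. (u x)\<^sup>2) \<ge> 0" by (simp add: sum_nonneg)
  ultimately have ug: "(u g)\<^sup>2 = 1" and "(\<Sum>x\<in>carrier G - {g}. (u x)\<^sup>2) = 0"
    using sum1 split by linarith+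
  then have "\<forall>x\<in>carrier G - {g}. u x = 0"
    using fin by (subst (asm) sum_nonneg_eq_0_iff) auto
  then have zero: "u x = 0" if "x \<noteq> g" for x
    using uc that by (auto simp: carrier_ZG)
  have "u g = 1 \<or> u g = -1" using ug by (simp add: power2_eq_1_iff)
  then show ?thesis
  proof
    assume "u g = 1"
    then have "u = group_element g" using zero by (auto simp: group_element_def fun_eq_iff)
    then show ?thesis using g(1) by (auto simp: trivial_central_units_def center_eq)
  next
    assume "u g = -1"
    then have "ev \<chi> u = ev \<chi> (\<lambda>x. - group_element g x)" for \<chi>
      using zero by (intro arg_cong[of _ _ "ev \<chi>"]) (auto simp: group_element_def fun_eq_iff)
    then have "u = \<ominus>\<^bsub>ZG\<^esub> group_element g"
      using g(1) uc by (intro ev_inject) (auto simp: ev_uminus ev_minus group_element_closed)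
    then show ?thesis using g(1) by (auto simp: trivial_central_units_def center_eq)
  qed
qed

text \<open>This is the discreteness of the logarithmic embedding. By Parseval an upper bound on
  every logarithm bounds the sum of the squared coefficients by \<open>exp B ^ 2\<close>, which
  leaves finitely many integer functions on \<open>G\<close>.\<close>

lemma finite_bounded_units:
  "finite {u \<in> Units ZG. \<forall>\<chi>\<in>characters. log_ev \<chi> u \<le> B}" (is "finite ?S")
proof -
  define N where "N = \<lceil>exp B ^ 2\<rceil>"
  have "?S \<subseteq> {f. \<forall>x. (x \<in> carrier G \<longrightarrow> f x \<in> {-N..N}) \<and> (x \<notin> carrier G \<longrightarrow> f x = 0)}"
  proof
    fix u assume uS: "u \<in> ?S"
    then have u: "u \<in> Units ZG" and B: "\<And>\<chi>. \<chi> \<in> characters \<Longrightarrow> log_ev \<chi> u \<le> B" by auto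
    have "(cmod (ev \<chi> u))\<^sup>2 \<le> exp B ^ 2" if \<chi>: "\<chi> \<in> characters" for \<chi>
    proof -
      have "cmod (ev \<chi> u) = exp (log_ev \<chi> u)"
        using ev_unit_nonzero[OF \<chi> u] by (simp add: log_ev_def)
      then show ?thesis using B[OF \<chi>] by (intro power_mono) auto
    qed
    then have "real (card characters) * (\<Sum>x\<in>carrier G. (real_of_int (u x))\<^sup>2) \<le> real (card characters) * exp B ^ 2"
      unfolding parseval[symmetric] by (rule sum_bounded_above)
    then have le: "(\<Sum>x\<in>carrier G. (real_of_int (u x))\<^sup>2) \<le> exp B ^ 2"
      using card_characters_pos by simp
    have "u x \<in> {-N..N}" if x: "x \<in> carrier G" for x
    proof -
      have "(real_of_int (u x))\<^sup>2 \<le> (\<Sum>x\<in>carrier G. (real_of_int (u x))\<^sup>2)"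
        using fin x by (intro member_le_sum) auto
      also note le
      also have "exp B ^ 2 \<le> real_of_int N" unfolding N_def by (rule le_of_int_ceiling)
      finally have "(u x)\<^sup>2 \<le> N" by (metis of_int_le_iff of_int_power)
      moreover have "\<bar>u x\<bar> * 1 \<le> \<bar>u x\<bar> * \<bar>u x\<bar>"
        by (cases "u x = 0") (simp, intro mult_left_mono, simp_all)
      then have "\<bar>u x\<bar> \<le> (u x)\<^sup>2" by (simp add: power2_eq_square)
      ultimately show ?thesis by auto
    qed
    then show "u \<in> {f. \<forall>x. (x \<in> carrier G \<longrightarrow> f x \<in> {-N..N}) \<and> (x \<notin> carrier G \<longrightarrow> f x = 0)}"
      using ZG.Units_closed[OF u] by (auto simp: carrier_ZG)
  qed
  then show ?thesis using finite_set_of_finite_funs[OF fin finite_atLeastAtMost_int, of "-N" N 0] by (rule finite_subset)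
qed

end

section \<open>The rank of the unit group\<close>


context finite_comm_group
begin

lemma log_ev_int_pow:
  assumes \<chi>: "\<chi> \<in> characters" and u: "u \<in> Units ZG"
  shows "log_ev \<chi> (u [^]\<^bsub>units_of ZG\<^esub> (k::int)) = k * log_ev \<chi> u"
proof -
  interpret U: comm_group "units_of ZG" by (rule comm_group_units)
  have nat: "u [^]\<^bsub>units_of ZG\<^esub> (n::nat) \<in> Units ZG \<and> log_ev \<chi> (u [^]\<^bsub>units_of ZG\<^esub> n) = n * log_ev \<chi> u" for n
  proof (induction n)
    case (Suc n)
    then show ?case
      using log_ev_mult[OF \<chi> _ u] u by (simp add: units_of_mult algebra_simps)
  qed (use \<chi> in \<open>simp add: log_ev_one units_of_one\<close>)
  show ?thesis
  proof (cases "k < 0")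
    case True
    have "u [^]\<^bsub>units_of ZG\<^esub> k = inv\<^bsub>units_of ZG\<^esub> (u [^]\<^bsub>units_of ZG\<^esub> nat (- k))"
      using True unfolding int_pow_def2 by (rule if_P)
    also have "\<dots> = inv\<^bsub>ZG\<^esub> (u [^]\<^bsub>units_of ZG\<^esub> nat (- k))"
      using nat by (intro ZG.units_of_inv) auto
    finally have eq: "u [^]\<^bsub>units_of ZG\<^esub> k = inv\<^bsub>ZG\<^esub> (u [^]\<^bsub>units_of ZG\<^esub> nat (- k))" .
    show ?thesis
      unfolding eq using log_ev_inv[OF \<chi>] nat[of "nat (- k)"] True by simp
  next
    case False
    then have eq: "u [^]\<^bsub>units_of ZG\<^esub> k = u [^]\<^bsub>units_of ZG\<^esub> nat k"
      unfolding int_pow_def2 by (rule if_not_P)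
    show ?thesis unfolding eq using nat[of "nat k"] False by simp
  qed
qed

lemma unit_int_pow: "u \<in> Units ZG \<Longrightarrow> u [^]\<^bsub>units_of ZG\<^esub> (k::int) \<in> Units ZG"
  using group.int_pow_closed[OF comm_group.axioms(2)[OF comm_group_units]] by (simp add: units_of_carrier)

text \<open>A free complement of rank at most 1 is cyclic, and trivial units have logarithm 0. Hence
  the logarithms of every unit form an integer multiple of one fixed vector, and all 2 by 2 minors
  vanish. All consequences of \<open>ecut G\<close> below are drawn through this lemma.\<close>

lemma log_ev_proportional:
  assumes "ecut G" and \<chi>: "\<chi> \<in> characters" and \<psi>: "\<psi> \<in> characters"
    and u: "u \<in> Units ZG" and v: "v \<in> Units ZG"
  shows "log_ev \<chi> u * log_ev \<psi> v = log_ev \<psi> u * log_ev \<chi> v"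
proof -
  interpret U: comm_group "units_of ZG" by (rule comm_group_units)
  obtain r where r: "r \<le> 1" and rank: "central_unit_rank G r"
    using assms(1) unfolding ecut_def by blast
  obtain A where "subgroup A (units_of ZG) \<and>
      (\<lambda>(t, a). t \<otimes>\<^bsub>units_of ZG\<^esub> a) \<in>
      iso ((units_of ZG)\<lparr>carrier := trivial_central_units G\<rparr> \<times>\<times> (units_of ZG)\<lparr>carrier := A\<rparr>) (units_of ZG) \<and>
      (units_of ZG)\<lparr>carrier := A\<rparr> \<cong> free_Abelian_group {..<r}"
    using rank unfolding central_unit_rank_def central_units_eq ..
  then have A: "subgroup A (units_of ZG)"
    and iso: "(\<lambda>(t, a). t \<otimes>\<^bsub>units_of ZG\<^esub> a) \<in>
      iso ((units_of ZG)\<lparr>carrier := trivial_central_units G\<rparr> \<times>\<times> (units_of ZG)\<lparr>carrier := A\<rparr>) (units_of ZG)"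
    and free: "(units_of ZG)\<lparr>carrier := A\<rparr> \<cong> free_Abelian_group {..<r}"
    by simp_all
  have grpA: "group ((units_of ZG)\<lparr>carrier := A\<rparr>)"
    using A by (rule U.subgroup_imp_group)
  have "cyclic_group (free_Abelian_group {..<r})"
  proof (cases "r = 0")
    case True
    have "trivial_group (free_Abelian_group ({}::nat set))"
      by (auto simp: trivial_group_def)
    then show ?thesis using True trivial_imp_cyclic_group by simp
  next
    case False
    then have "{..<r} = {0}" using r by auto
    then show ?thesis
      using isomorphic_group_cyclicity[OF isomorphic_group_integer_free_Abelian_group_singleton[of 0]] by simp
  qed
  then have "cyclic_group ((units_of ZG)\<lparr>carrier := A\<rparr>)"
    using isomorphic_group_cyclicity[OF free grpA] by simp
  then obtain a where a: "a \<in> A" "A = range (\<lambda>n::int. a [^]\<^bsub>(units_of ZG)\<lparr>carrier := A\<rparr>\<^esub> n)"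
    unfolding group.cyclic_group[OF grpA] by auto
  have aA: "A = range (\<lambda>n::int. a [^]\<^bsub>units_of ZG\<^esub> n)"
    using a U.int_pow_consistent[OF A a(1)] by simp
  have aU: "a \<in> Units ZG" using subgroup.subset[OF A] a(1) by (auto simp: units_of_carrier)
  \<comment> \<open>The order of the quantifiers matters: one exponent \<open>k\<close> serves all
    characters.\<close>
  have decomp: "\<exists>k::int. \<forall>\<chi>\<in>characters. log_ev \<chi> w = k * log_ev \<chi> a" if w: "w \<in> Units ZG" for w
  proof -
    have "(\<lambda>(t, a). t \<otimes>\<^bsub>units_of ZG\<^esub> a) ` (trivial_central_units G \<times> A) = Units ZG"
      using iso by (simp add: iso_def bij_betw_def units_of_carrier)
    then obtain t b where t: "t \<in> trivial_central_units G" "b \<in> A" "w = t \<otimes>\<^bsub>ZG\<^esub> b"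
      using w by (force simp: units_of_mult)
    obtain k :: int where "b = a [^]\<^bsub>units_of ZG\<^esub> k" using t(2) aA by auto
    moreover have "t \<in> Units ZG" "b \<in> Units ZG"
      using trivial_units_subset subgroup.subset[OF A] t by (auto simp: units_of_carrier)
    ultimately show ?thesis
      using t(1,3) aU by (intro exI[of _ k]) (auto simp: log_ev_mult log_ev_trivial log_ev_int_pow)
  qed
  obtain i j :: int where "\<forall>\<chi>\<in>characters. log_ev \<chi> u = i * log_ev \<chi> a"
    "\<forall>\<chi>\<in>characters. log_ev \<chi> v = j * log_ev \<chi> a"
    using decomp u v by meson
  then show ?thesis using \<chi> \<psi> by simp
qed

text \<open>Minimality and division with remainder, as for a discrete subgroup of the reals. By
  \<open>dep\<close> a bound at \<open>\<chi>0\<close> bounds the logarithms at all characters, so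
  only finitely many units satisfy it.\<close>

lemma discrete_log_ev:
  assumes \<chi>0: "\<chi>0 \<in> characters"
    and dep: "\<And>\<chi> u. \<lbrakk>\<chi> \<in> characters; u \<in> Units ZG\<rbrakk> \<Longrightarrow> log_ev \<chi> u \<le> \<bar>log_ev \<chi>0 u\<bar>"
    and nontriv: "u1 \<in> Units ZG" "log_ev \<chi>0 u1 \<noteq> 0"
  shows "\<exists>a\<in>Units ZG. log_ev \<chi>0 a \<noteq> 0 \<and> (\<forall>u\<in>Units ZG. \<exists>k::int. log_ev \<chi>0 u = k * log_ev \<chi>0 a)"
proof -
  interpret U: comm_group "units_of ZG" by (rule comm_group_units)
  define u2 where "u2 = (if log_ev \<chi>0 u1 > 0 then u1 else inv\<^bsub>ZG\<^esub> u1)"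
  have u2: "u2 \<in> Units ZG" "log_ev \<chi>0 u2 > 0"
    using nontriv \<chi>0 log_ev_inv by (auto simp: u2_def)
  \<comment> \<open>The cap \<open>log_ev \<chi>0 u2\<close> makes \<open>S\<close> finite, and
    \<open>u2\<close> itself keeps it nonempty. A remainder with logarithm below \<open>c\<close>
    stays under the cap, so minimality applies to it.\<close>
  define S where "S = {u \<in> Units ZG. 0 < log_ev \<chi>0 u \<and> log_ev \<chi>0 u \<le> log_ev \<chi>0 u2}"
  have "S \<subseteq> {u \<in> Units ZG. \<forall>\<chi>\<in>characters. log_ev \<chi> u \<le> log_ev \<chi>0 u2}"
  proof (clarsimp simp: S_def)
    fix u \<chi> assume u: "u \<in> Units ZG" "0 < log_ev \<chi>0 u" "log_ev \<chi>0 u \<le> log_ev \<chi>0 u2" and \<chi>: "\<chi> \<in> characters"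
    show "log_ev \<chi> u \<le> log_ev \<chi>0 u2" using dep[OF \<chi> u(1)] u(2,3) by linarith
  qed
  then have fS: "finite S" using finite_bounded_units by (rule finite_subset)
  have S0: "S \<noteq> {}" using u2 by (auto simp: S_def)
  obtain a where a: "a \<in> S" and min: "\<And>u. u \<in> S \<Longrightarrow> log_ev \<chi>0 a \<le> log_ev \<chi>0 u"
    using arg_min_if_finite[OF fS S0, of "log_ev \<chi>0"] by (metis not_less)
  define c where "c = log_ev \<chi>0 a"
  have aU: "a \<in> Units ZG" and c: "c > 0" "c \<le> log_ev \<chi>0 u2" using a by (auto simp: S_def c_def)
  have "\<exists>k::int. log_ev \<chi>0 u = k * c" if u: "u \<in> Units ZG" for u
  proof -
    define k where "k = \<lfloor>log_ev \<chi>0 u / c\<rfloor>"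
    define w where "w = u \<otimes>\<^bsub>ZG\<^esub> (a [^]\<^bsub>units_of ZG\<^esub> (-k))"
    have w: "w \<in> Units ZG" using u unit_int_pow[OF aU] by (simp add: w_def)
    have lw: "log_ev \<chi>0 w = log_ev \<chi>0 u - k * c"
      using log_ev_mult[OF \<chi>0 u unit_int_pow[OF aU]] log_ev_int_pow[OF \<chi>0 aU] by (simp add: w_def c_def)
    have "k \<le> log_ev \<chi>0 u / c" "log_ev \<chi>0 u / c < k + 1" by (simp_all add: k_def)
    then have "k * c \<le> log_ev \<chi>0 u" "log_ev \<chi>0 u < k * c + c"
      using c by (simp_all add: field_simps)
    then have "0 \<le> log_ev \<chi>0 w" "log_ev \<chi>0 w < c" using lw by simp_all
    moreover have "\<not> 0 < log_ev \<chi>0 w"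
    proof
      assume "0 < log_ev \<chi>0 w"
      then have "w \<in> S" using w \<open>log_ev \<chi>0 w < c\<close> c(2) by (simp add: S_def)
      then show False using min[of w] \<open>log_ev \<chi>0 w < c\<close> by (simp add: c_def)
    qed
    ultimately have "log_ev \<chi>0 w = 0" by linarith
    then show ?thesis using lw by (intro exI[of _ k]) simp
  qed
  then show ?thesis using aU c(1) by (intro bexI[of _ a]) (simp_all add: c_def)
qed

text \<open>By \<open>dep\<close> and \<open>trivial_unitI\<close> the logarithm at
  \<open>\<chi>0\<close> alone has the trivial units as its kernel. Its image is generated by the
  logarithm of some \<open>a\<close>, so the powers of \<open>a\<close> form a complement.\<close>

lemma ecutI:
  assumes \<chi>0: "\<chi>0 \<in> characters"
    and dep: "\<And>\<chi> u. \<lbrakk>\<chi> \<in> characters; u \<in> Units ZG\<rbrakk> \<Longrightarrow> log_ev \<chi> u = 0 \<or> \<bar>log_ev \<chi> u\<bar> = \<bar>log_ev \<chi>0 u\<bar>"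
  shows "ecut G"
proof -
  interpret U: comm_group "units_of ZG" by (rule comm_group_units)
  let ?T = "trivial_central_units G"
  have le: "log_ev \<chi> u \<le> \<bar>log_ev \<chi>0 u\<bar>" if "\<chi> \<in> characters" "u \<in> Units ZG" for \<chi> u
    using dep[OF that] by linarith
  \<comment> \<open>If the logarithm at \<open>\<chi>0\<close> vanishes on all units,
    \<open>a\<close> is chosen to be the identity, so that the complement is trivial and the rank is
    0 instead of 1.\<close>
  obtain a where a: "a \<in> Units ZG" and surj: "\<And>u. u \<in> Units ZG \<Longrightarrow> \<exists>k::int. log_ev \<chi>0 u = k * log_ev \<chi>0 a"
    and c0: "log_ev \<chi>0 a = 0 \<Longrightarrow> a = \<one>\<^bsub>ZG\<^esub>"
  proof (cases "\<exists>u\<in>Units ZG. log_ev \<chi>0 u \<noteq> 0")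
    case True
    then show ?thesis using discrete_log_ev[OF \<chi>0 le] that by blast
  next
    case False
    then show ?thesis using that[of "\<one>\<^bsub>ZG\<^esub>"] by simp
  qed
  let ?p = "\<lambda>k::int. a [^]\<^bsub>units_of ZG\<^esub> k"
  define A where "A = range ?p"
  have aC: "a \<in> carrier (units_of ZG)" using a by (simp add: units_of_carrier)
  have pU: "?p k \<in> Units ZG" for k using unit_int_pow[OF a] .
  have Lp: "log_ev \<chi>0 (?p k) = k * log_ev \<chi>0 a" for k by (rule log_ev_int_pow[OF \<chi>0 a])
  have padd: "?p i \<otimes>\<^bsub>units_of ZG\<^esub> ?p j = ?p (i + j)" for i j
    using aC by (simp add: U.int_pow_mult)
  have pinj: "?p i = ?p j" if "log_ev \<chi>0 (?p i) = log_ev \<chi>0 (?p j)" for i j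
  proof (cases "log_ev \<chi>0 a = 0")
    case True
    then have "a = \<one>\<^bsub>units_of ZG\<^esub>" using c0 by (simp add: units_of_one)
    then show ?thesis by (simp add: U.int_pow_one)
  next
    case False
    then show ?thesis using that by (simp add: Lp)
  qed
  have Tsub: "subgroup ?T (units_of ZG)"
    using subgroup_trivial_central_units[OF is_group fin] by (simp add: central_units_eq)
  have TU: "t \<in> carrier (units_of ZG)" if "t \<in> ?T" for t using subgroup.mem_carrier[OF Tsub that] .
  have pC: "?p k \<in> carrier (units_of ZG)" for k using aC by simp
  have sub: "subgroup A (units_of ZG)"
  proof (rule U.subgroupI)
    show "A \<subseteq> carrier (units_of ZG)" using pC by (auto simp: A_def)
    fix x assume "x \<in> A"
    then obtain i where x: "x = ?p i" by (auto simp: A_def)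
    have "inv\<^bsub>units_of ZG\<^esub> x = ?p (- i)" using aC x by (simp add: U.int_pow_neg)
    then show "inv\<^bsub>units_of ZG\<^esub> x \<in> A" by (auto simp: A_def)
    fix y assume "y \<in> A"
    then show "x \<otimes>\<^bsub>units_of ZG\<^esub> y \<in> A" using x padd by (auto simp: A_def)
  qed (auto simp: A_def)
  have iso: "(\<lambda>(t, b). t \<otimes>\<^bsub>units_of ZG\<^esub> b) \<in>
      iso ((units_of ZG)\<lparr>carrier := ?T\<rparr> \<times>\<times> (units_of ZG)\<lparr>carrier := A\<rparr>) (units_of ZG)"
  proof -
    have AC: "b \<in> carrier (units_of ZG)" if "b \<in> A" for b using subgroup.mem_carrier[OF sub that] .
    have "(\<lambda>(t, b). t \<otimes>\<^bsub>units_of ZG\<^esub> b) \<in>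
        hom ((units_of ZG)\<lparr>carrier := ?T\<rparr> \<times>\<times> (units_of ZG)\<lparr>carrier := A\<rparr>) (units_of ZG)"
      using TU AC by (auto simp: hom_def DirProd_def U.m_ac)
    moreover have "inj_on (\<lambda>(t, b). t \<otimes>\<^bsub>units_of ZG\<^esub> b) (?T \<times> A)"
    proof (rule inj_onI, clarify)
      fix t b s d assume ts: "t \<in> ?T" "b \<in> A" "s \<in> ?T" "d \<in> A"
        and eq: "t \<otimes>\<^bsub>units_of ZG\<^esub> b = s \<otimes>\<^bsub>units_of ZG\<^esub> d"
      obtain i j where ij: "b = ?p i" "d = ?p j" using ts by (auto simp: A_def)
      have "log_ev \<chi>0 (t \<otimes>\<^bsub>ZG\<^esub> b) = log_ev \<chi>0 (s \<otimes>\<^bsub>ZG\<^esub> d)" using eq by (simp add: units_of_mult)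
      then have "log_ev \<chi>0 b = log_ev \<chi>0 d"
        using ts ij pU TU \<chi>0 by (simp add: log_ev_mult log_ev_trivial units_of_carrier)
      then have "b = d" using pinj ij by simp
      then show "t = s \<and> b = d" using eq TU[OF ts(1)] TU[OF ts(3)] AC[OF ts(4)] by simp
    qed
    moreover have "(\<lambda>(t, b). t \<otimes>\<^bsub>units_of ZG\<^esub> b) ` (?T \<times> A) = carrier (units_of ZG)"
    proof (intro equalityI subsetI)
      fix u assume u: "u \<in> carrier (units_of ZG)"
      then have uU: "u \<in> Units ZG" by (simp add: units_of_carrier)
      obtain k :: int where k: "log_ev \<chi>0 u = k * log_ev \<chi>0 a" using surj[OF uU] by blast
      \<comment> \<open>Dividing \<open>u\<close> by the matching power of \<open>a\<close> leaves
        logarithm 0 at \<open>\<chi>0\<close>, hence by \<open>dep\<close> at every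
        character.\<close>
      define t where "t = u \<otimes>\<^bsub>units_of ZG\<^esub> ?p (- k)"
      have tU: "t \<in> Units ZG" using u pC unfolding t_def by (metis U.m_closed units_of_carrier)
      have "log_ev \<chi>0 t = 0"
        using log_ev_mult[OF \<chi>0 uU pU] by (simp add: t_def units_of_mult Lp k)
      then have "log_ev \<chi> t = 0" if "\<chi> \<in> characters" for \<chi> using dep[OF that tU] by auto
      then have "t \<in> ?T" using trivial_unitI[OF tU] by blast
      moreover have "u = t \<otimes>\<^bsub>units_of ZG\<^esub> ?p k"
        using u pC by (simp add: t_def U.m_assoc padd)
      moreover have "?p k \<in> A" by (simp add: A_def)
      ultimately show "u \<in> (\<lambda>(t, b). t \<otimes>\<^bsub>units_of ZG\<^esub> b) ` (?T \<times> A)"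
        by (intro image_eqI[of _ _ "(t, ?p k)"]) auto
    qed (use TU AC in auto)
    ultimately show ?thesis by (simp add: iso_def bij_betw_def DirProd_def)
  qed
  have "\<exists>r::nat. r \<le> 1 \<and> (units_of ZG)\<lparr>carrier := A\<rparr> \<cong> free_Abelian_group {..<r}"
  proof (cases "log_ev \<chi>0 a = 0")
    case True
    then have a1: "a = \<one>\<^bsub>units_of ZG\<^esub>" using c0 by (simp add: units_of_one)
    have "?p k = \<one>\<^bsub>units_of ZG\<^esub>" for k unfolding a1 by (rule U.int_pow_one)
    then have A1: "A = {\<one>\<^bsub>units_of ZG\<^esub>}" by (simp add: A_def image_constant_conv)
    have "carrier (free_Abelian_group ({..<0}::nat set)) = {0}" by auto
    then have "(\<lambda>_. 0) \<in> iso ((units_of ZG)\<lparr>carrier := A\<rparr>) (free_Abelian_group ({..<0}::nat set))"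
      using A1 by (simp add: iso_def hom_def bij_betw_def)
    then have "(units_of ZG)\<lparr>carrier := A\<rparr> \<cong> free_Abelian_group ({..<0}::nat set)"
      unfolding is_iso_def by blast
    then show ?thesis by (intro exI[of _ "0::nat"] conjI zero_le_one)
  next
    case False
    have "?p \<in> iso integer_group ((units_of ZG)\<lparr>carrier := A\<rparr>)"
    proof -
      have "inj ?p"
      proof (rule injI)
        fix i j assume "?p i = ?p j"
        then have "i * log_ev \<chi>0 a = j * log_ev \<chi>0 a" using Lp by metis
        then show "i = j" using False by simp
      qed
      then show ?thesis by (auto simp: iso_def hom_def bij_betw_def A_def padd)
    qed
    then have "integer_group \<cong> (units_of ZG)\<lparr>carrier := A\<rparr>" by (auto simp: is_iso_def)
    then have "(units_of ZG)\<lparr>carrier := A\<rparr> \<cong> free_Abelian_group {0::nat}"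
      by (rule iso_trans[OF group.iso_sym[OF group_integer_group] isomorphic_group_integer_free_Abelian_group_singleton])
    moreover have "{0::nat} = {..<1}" by auto
    ultimately show ?thesis by (intro exI[of _ 1]) simp
  qed
  then obtain r :: nat where r: "r \<le> 1" "(units_of ZG)\<lparr>carrier := A\<rparr> \<cong> free_Abelian_group {..<r}" by blast
  have "central_unit_rank G r"
    unfolding central_unit_rank_def central_units_eq using sub iso r(2) by (intro exI[of _ A] conjI)
  then show ?thesis unfolding ecut_def using r(1) by blast
qed

end

section \<open>Groups with at most one fundamental unit\<close>


text \<open>For roots \<open>s\<close>, \<open>t\<close> of a monic quadratic, \<open>y\<close> is the Galois conjugate of \<open>x\<close> in the order \<open>\<int>[s]\<close>.\<close>

definition conj_rel :: "real \<Rightarrow> real \<Rightarrow> real \<Rightarrow> real \<Rightarrow> bool" where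
  "conj_rel s t x y \<longleftrightarrow> (\<exists>(a::int) (b::int). x = a + b * s \<and> y = a + b * t)"

lemma conj_rel_int: "conj_rel s t (of_int a) (of_int a)"
  unfolding conj_rel_def by (rule exI[of _ a], rule exI[of _ 0]) simp

lemma conj_rel_base: "conj_rel s t s t"
  unfolding conj_rel_def by (rule exI[of _ 0], rule exI[of _ 1]) simp

lemma conj_rel_add:
  assumes "conj_rel s t x y" "conj_rel s t x' y'"
  shows "conj_rel s t (x + x') (y + y')"
proof -
  obtain a b a' b' :: int where "x = a + b * s" "y = a + b * t" "x' = a' + b' * s" "y' = a' + b' * t"
    using assms unfolding conj_rel_def by blast
  then show ?thesis unfolding conj_rel_def
    by (intro exI[of _ "a + a'"] exI[of _ "b + b'"]) (simp add: algebra_simps)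
qed

text \<open>Both \<open>s\<close> and \<open>t\<close> satisfy the same monic equation, so reducing
  a product by it produces the same integer coordinates for both.\<close>

lemma conj_rel_mult:
  assumes s: "s\<^sup>2 = of_int p * s + of_int q" and t: "t\<^sup>2 = of_int p * t + of_int q"
    and "conj_rel s t x y" "conj_rel s t x' y'"
  shows "conj_rel s t (x * x') (y * y')"
proof -
  obtain a b a' b' :: int where ab: "x = a + b * s" "y = a + b * t" "x' = a' + b' * s" "y' = a' + b' * t"
    using assms(3,4) unfolding conj_rel_def by blast
  have "(a + b * r) * (a' + b' * r) = of_int (a * a' + b * b' * q) + of_int (a * b' + b * a' + b * b' * p) * r"
    if "r\<^sup>2 = of_int p * r + of_int q" for r :: real
  proof -
    have "(a + b * r) * (a' + b' * r) = a * a' + (a * b' + b * a') * r + b * b' * r\<^sup>2"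
      by (simp add: algebra_simps power2_eq_square)
    then show ?thesis unfolding that by (simp add: algebra_simps)
  qed
  from this[OF s] this[OF t] show ?thesis unfolding conj_rel_def ab by blast
qed

lemma conj_rel_mult_int: "conj_rel s t x y \<Longrightarrow> conj_rel s t (of_int k * x) (of_int k * y)"
proof -
  assume "conj_rel s t x y"
  then obtain a b :: int where "x = a + b * s" "y = a + b * t"
    unfolding conj_rel_def by blast
  then show ?thesis unfolding conj_rel_def
    by (intro exI[of _ "k * a"] exI[of _ "k * b"]) (simp add: algebra_simps)
qed

lemma conj_rel_sum:
  "(\<And>j. j \<in> D \<Longrightarrow> conj_rel s t (x j) (y j)) \<Longrightarrow> conj_rel s t (sum x D) (sum y D)"
  by (induction D rule: infinite_finite_induct)
    (use conj_rel_int[of s t 0] in \<open>auto intro: conj_rel_add\<close>)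

text \<open>Adding one term \<open>e\<close> changes the squared absolute value by
  \<open>(c e)\<^sup>2\<close> and by mixed terms that carry the factor
  \<open>2 * Re (z x * cnj (z e))\<close>. The 2 is what keeps them in the order, since a real part
  alone may be half of one of its elements.\<close>

lemma conj_rel_norm:
  assumes "finite D"
    and "\<And>x y. \<lbrakk>x \<in> D; y \<in> D\<rbrakk> \<Longrightarrow> conj_rel s t (2 * Re (z x * cnj (z y))) (2 * Re (w x * cnj (w y)))"
    and "\<And>x. x \<in> D \<Longrightarrow> cmod (z x) = 1 \<and> cmod (w x) = 1"
  shows "conj_rel s t ((cmod (\<Sum>x\<in>D. of_int (c x) * z x))\<^sup>2) ((cmod (\<Sum>x\<in>D. of_int (c x) * w x))\<^sup>2)"
  using assms
proof (induction D rule: finite_induct)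
  case empty
  show ?case using conj_rel_int[of s t 0] by simp
next
  case (insert e D)
  have expand: "(cmod (of_int (c e) * z e + S))\<^sup>2 =
      (cmod S)\<^sup>2 + of_int ((c e)\<^sup>2) + of_int (c e) * (2 * Re (S * cnj (z e)))"
    if "cmod (z e) = 1" for S and z :: "'a \<Rightarrow> complex"
  proof -
    have "(Re (z e))\<^sup>2 + (Im (z e))\<^sup>2 = 1" using that by (simp flip: cmod_power2)
    then have "(of_int (c e))\<^sup>2 * ((Re (z e))\<^sup>2 + (Im (z e))\<^sup>2) = (of_int ((c e)\<^sup>2) :: real)" by simp
    then show ?thesis by (simp add: cmod_power2 power2_sum power_mult_distrib algebra_simps)
  qed
  have cross: "2 * Re ((\<Sum>x\<in>D. of_int (c x) * z x) * cnj (z e)) = (\<Sum>x\<in>D. of_int (c x) * (2 * Re (z x * cnj (z e))))"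
    for z :: "'a \<Rightarrow> complex"
    by (simp add: sum_distrib_right sum_distrib_left mult.assoc) (simp add: algebra_simps)
  have "conj_rel s t (2 * Re ((\<Sum>x\<in>D. of_int (c x) * z x) * cnj (z e))) (2 * Re ((\<Sum>x\<in>D. of_int (c x) * w x) * cnj (w e)))"
    unfolding cross by (intro conj_rel_sum conj_rel_mult_int insert.prems) auto
  moreover have "conj_rel s t ((cmod (\<Sum>x\<in>D. of_int (c x) * z x))\<^sup>2) ((cmod (\<Sum>x\<in>D. of_int (c x) * w x))\<^sup>2)"
    using insert.prems by (intro insert.IH) auto
  moreover have ze: "cmod (z e) = 1" "cmod (w e) = 1" using insert.prems by auto
  ultimately show ?case
    unfolding sum.insert[OF insert.hyps] expand[of z, OF ze(1)] expand[of w, OF ze(2)]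
    by (intro conj_rel_add conj_rel_mult_int conj_rel_int)
qed

text \<open>This is the norm of the quadratic order: expanding the product leaves only
  \<open>s + t\<close> and \<open>s * t\<close>, both integers.\<close>

lemma conj_rel_prod_int:
  assumes "s + t = of_int p" "s * t = of_int q" "conj_rel s t x y"
  shows "\<exists>n::int. x * y = of_int n"
proof -
  obtain a b :: int where ab: "x = a + b * s" "y = a + b * t"
    using assms(3) unfolding conj_rel_def by blast
  have "x * y = a * a + a * b * (s + t) + b * b * (s * t)"
    unfolding ab by (simp add: algebra_simps)
  also have "\<dots> = of_int (a * a + a * b * p + b * b * q)" unfolding assms(1,2) by simp
  finally show ?thesis by blast
qed

text \<open>Chebyshev's recurrence: on the unit circle
  \<open>v ^ (k + 2) + v ^ k = (v + cnj v) * v ^ (k + 1)\<close>, so twice the real part of a power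
  is an integer polynomial in \<open>2 * Re v\<close>.\<close>

lemma conj_rel_pow:
  assumes s: "s\<^sup>2 = of_int p * s + of_int q" and t: "t\<^sup>2 = of_int p * t + of_int q"
    and z: "cmod z = 1" and w: "cmod w = 1" and "conj_rel s t (2 * Re z) (2 * Re w)"
  shows "conj_rel s t (2 * Re (z ^ k)) (2 * Re (w ^ k))"
proof (induction k rule: less_induct)
  case (less k)
  have rec: "2 * Re (v ^ Suc (Suc k)) = 2 * Re v * (2 * Re (v ^ Suc k)) + of_int (-1) * (2 * Re (v ^ k))"
    if "cmod v = 1" for v k
  proof -
    have "v * cnj v = 1" using that by (simp add: complex_norm_square[symmetric])
    then have "v ^ Suc (Suc k) + v ^ k = (v + cnj v) * v ^ Suc k"
      by (simp add: algebra_simps)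
    also have "v + cnj v = complex_of_real (2 * Re v)" by (rule complex_add_cnj)
    finally have "Re (v ^ Suc (Suc k) + v ^ k) = Re (complex_of_real (2 * Re v) * v ^ Suc k)"
      by (rule arg_cong)
    then have "Re (v ^ Suc (Suc k)) + Re (v ^ k) = 2 * Re v * Re (v ^ Suc k)"
      unfolding plus_complex.simps Re_complex_of_real times_complex.simps Im_complex_of_real by simp
    then show ?thesis by (simp add: algebra_simps del: power_Suc)
  qed
  consider "k = 0" | "k = 1" | j where "k = Suc (Suc j)"
    by (metis One_nat_def not0_implies_Suc)
  then show ?case
  proof cases
    case 1
    then show ?thesis using conj_rel_int[of s t 2] by simp
  next
    case 2
    then show ?thesis using assms by simp
  next
    case 3
    have IH: "conj_rel s t (2 * Re (z ^ Suc j)) (2 * Re (w ^ Suc j))" "conj_rel s t (2 * Re (z ^ j)) (2 * Re (w ^ j))"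
      using less[of "Suc j"] less[of j] 3 by auto
    show ?thesis unfolding 3 rec[OF z] rec[OF w]
      by (rule conj_rel_add[OF conj_rel_mult[OF s t assms(5) IH(1)] conj_rel_mult_int[OF IH(2)]])
  qed
qed

text \<open>\<open>t\<close> is the trace \<open>z + w\<close>, where \<open>w = cnj z\<close> is
  the inverse of \<open>z\<close>. An even exponent \<open>2 n\<close> gives
  \<open>z ^ n = w ^ n\<close>, and \<open>z ^ n - w ^ n\<close> is \<open>z - w\<close> times a
  polynomial in \<open>z + w\<close> and \<open>z * w\<close>, whose zeros are the possible traces;
  \<open>z = w\<close> means that \<open>z\<close> is 1 or -1.\<close>

lemma Re_root_of_unity:
  fixes z :: complex
  defines "t \<equiv> 2 * Re z"
  shows "z ^ 4 = 1 \<Longrightarrow> t \<in> \<int>" and "z ^ 6 = 1 \<Longrightarrow> t \<in> \<int>"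
    and "z ^ 5 = 1 \<Longrightarrow> t \<in> \<int> \<or> t\<^sup>2 = - t + 1"
    and "z ^ 8 = 1 \<Longrightarrow> t \<in> \<int> \<or> t\<^sup>2 = 2"
    and "z ^ 12 = 1 \<Longrightarrow> t \<in> \<int> \<or> t\<^sup>2 = 3"
proof -
  define w where "w = cnj z"
  have norm: "z * w = 1" if "z ^ n = 1" "n > 0" for n
  proof -
    have "cmod z ^ n = 1" using that(1) by (metis norm_one norm_power)
    then have "cmod z = 1" using that(2) power_eq_imp_eq_base[of "cmod z" n 1] by simp
    then show ?thesis by (simp add: w_def complex_norm_square[symmetric])
  qed
  have tc: "complex_of_real t = z + w" by (simp add: t_def w_def complex_add_cnj)
  have real: "t \<in> \<int>" if "z = w" "z * w = 1"
  proof -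
    have "(complex_of_real t)\<^sup>2 = 4" unfolding tc using that by (simp add: power2_eq_square algebra_simps)
    then have "t\<^sup>2 = 2\<^sup>2" using of_real_eq_iff[of "t\<^sup>2" 4, where 'a = complex] by (simp del: of_real_eq_iff)
    then have "t = 2 \<or> t = -2" unfolding power2_eq_iff .
    then show ?thesis by auto
  qed
  have pm: "z ^ Suc k * w ^ Suc k = 1" if "z * w = 1" for k using that by (metis power_mult_distrib power_one)
  have half: "(z - w) * r = 0" if "z * w = 1" "z ^ (n + n) = 1" "z ^ n - w ^ n = (z - w) * r" for n r
  proof -
    have "w ^ n * z ^ n = 1" using that(1) by (metis mult.commute power_mult_distrib power_one)
    then have "z ^ n = w ^ n" using that(2) by (metis mult.assoc mult.right_neutral mult_1 power_add)
    then show ?thesis using that(3) by simp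
  qed
  have int: "t \<in> \<int>" if "t\<^sup>2 = 1" using that by (auto simp: power2_eq_1_iff)
  have real_eq: "t\<^sup>2 = of_int a" if "(z + w)\<^sup>2 = of_int a" for a
    using that unfolding tc[symmetric] by (metis of_real_eq_iff of_real_of_int_eq of_real_power)
  {
    assume "z ^ 4 = 1"
    then have zw: "z * w = 1" using norm by fastforce
    have "(z - w) * (z + w) = 0"
      by (rule half[OF zw, of 2]) (use \<open>z ^ 4 = 1\<close> in \<open>simp_all add: algebra_simps power2_eq_square\<close>)
    then show "t \<in> \<int>" using real[OF _ zw] tc by auto
  }
  {
    assume "z ^ 6 = 1"
    then have zw: "z * w = 1" using norm by fastforce
    have "(z - w) * ((z + w)\<^sup>2 - z * w) = 0"
      by (rule half[OF zw, of 3]) (use \<open>z ^ 6 = 1\<close> in \<open>simp_all add: algebra_simps power2_eq_square power3_eq_cube\<close>)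
    then have "z = w \<or> (z + w)\<^sup>2 = of_int 1" using zw by simp
    then show "t \<in> \<int>" using real[OF _ zw] real_eq[of 1] int by auto
  }
  {
    assume "z ^ 8 = 1"
    then have zw: "z * w = 1" using norm by fastforce
    have "(z - w) * ((z + w) * ((z + w)\<^sup>2 - 2 * (z * w))) = 0"
      by (rule half[OF zw, of 4]) (use \<open>z ^ 8 = 1\<close> in \<open>simp_all add: algebra_simps power2_eq_square power4_eq_xxxx\<close>)
    then have "z = w \<or> z + w = 0 \<or> (z + w)\<^sup>2 = of_int 2" using zw by simp
    then show "t \<in> \<int> \<or> t\<^sup>2 = 2" using real[OF _ zw] real_eq[of 2] tc by auto
  }
  {
    assume "z ^ 12 = 1"
    then have zw: "z * w = 1" using norm by fastforce
    have "(z - w) * (((z + w)\<^sup>2 - z * w) * ((z + w) * ((z + w)\<^sup>2 - 3 * (z * w)))) = 0"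
      by (rule half[OF zw, of 6]) (use \<open>z ^ 12 = 1\<close> in \<open>simp_all add: algebra_simps power2_eq_square eval_nat_numeral\<close>)
    then have "z = w \<or> (z + w)\<^sup>2 = of_int 1 \<or> z + w = 0 \<or> (z + w)\<^sup>2 = of_int 3" using zw by simp
    then show "t \<in> \<int> \<or> t\<^sup>2 = 3" using real[OF _ zw] real_eq[of 1] real_eq[of 3] int tc by auto
  }
  {
    assume z5: "z ^ 5 = 1"
    then have zw: "z * w = 1" using norm by fastforce
    have "(z - 1) * (1 + z + z^2 + z^3 + z^4) = 0"
      using z5 by (simp add: algebra_simps eval_nat_numeral)
    \<comment> \<open>Multiplying the fifth cyclotomic polynomial by \<open>w\<^sup>2\<close>, the
      inverse of \<open>z\<^sup>2\<close>, makes it symmetric in \<open>z\<close> and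
      \<open>w\<close>, hence a polynomial in the trace.\<close>
    then have "z = 1 \<or> w\<^sup>2 * (1 + z + z^2 + z^3 + z^4) = 0" by auto
    moreover have "w\<^sup>2 * (1 + z + z^2 + z^3 + z^4) =
        w\<^sup>2 + w * (z * w) + (z * w)^2 + z * (z * w)^2 + z\<^sup>2 * (z * w)^2"
      by (simp add: algebra_simps eval_nat_numeral)
    ultimately have "z = 1 \<or> w\<^sup>2 + w + 1 + z + z\<^sup>2 = 0" unfolding zw by simp
    moreover have "w\<^sup>2 + w + 1 + z + z\<^sup>2 = (z + w)\<^sup>2 + (z + w) - 1"
      using zw by (simp add: power2_sum mult.assoc)
    ultimately have "z = 1 \<or> (complex_of_real t)\<^sup>2 + complex_of_real t - 1 = 0" unfolding tc by simp
    moreover have "(complex_of_real t)\<^sup>2 + complex_of_real t - 1 = complex_of_real (t\<^sup>2 + t - 1)" by simp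
    ultimately have "z = 1 \<or> t\<^sup>2 + t - 1 = 0" by (metis of_real_eq_0_iff)
    then show "t \<in> \<int> \<or> t\<^sup>2 = - t + 1" by (auto simp: t_def)
  }
qed

section \<open>Norms of units at conjugate characters\<close>

context finite_comm_group
begin

text \<open>The mixed terms of the squared absolute value are again character values, as
  \<open>\<chi> x * cnj (\<chi> y) = \<chi> (x \<otimes> inv y)\<close>.\<close>

lemma conj_rel_ev:
  assumes \<chi>: "\<chi> \<in> characters" and \<psi>: "\<psi> \<in> characters"
    and rel: "\<And>x. x \<in> carrier G \<Longrightarrow> conj_rel s t (2 * Re (\<chi> x)) (2 * Re (\<psi> x))"
  shows "conj_rel s t ((cmod (ev \<chi> u))\<^sup>2) ((cmod (ev \<psi> u))\<^sup>2)"
  unfolding ev_def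
proof (rule conj_rel_norm[OF fin])
  fix x y assume xy: "x \<in> carrier G" "y \<in> carrier G"
  have "\<chi> x * cnj (\<chi> y) = \<chi> (x \<otimes> inv y)" "\<psi> x * cnj (\<psi> y) = \<psi> (x \<otimes> inv y)"
    using xy \<chi> \<psi> by (simp_all add: char_mult char_inv)
  then show "conj_rel s t (2 * Re (\<chi> x * cnj (\<chi> y))) (2 * Re (\<psi> x * cnj (\<psi> y)))"
    using rel xy by simp
qed (use \<chi> \<psi> in \<open>simp add: cmod_char\<close>)

text \<open>The integers attached to \<open>u\<close> and to its inverse have product 1, and the
  first is nonnegative, so it is 1; taking logarithms gives the sum.\<close>

lemma unit_int_norm:
  assumes u: "u \<in> Units ZG" and \<chi>: "\<chi> \<in> characters" and \<psi>: "\<psi> \<in> characters"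
    and int: "\<And>v. v \<in> Units ZG \<Longrightarrow> \<exists>n::int. (cmod (ev \<chi> v))\<^sup>2 * (cmod (ev \<psi> v))\<^sup>2 = of_int n"
  shows "log_ev \<chi> u + log_ev \<psi> u = 0"
proof -
  let ?N = "\<lambda>v. (cmod (ev \<chi> v))\<^sup>2 * (cmod (ev \<psi> v))\<^sup>2"
  let ?v = "inv\<^bsub>ZG\<^esub> u"
  have v: "?v \<in> Units ZG" using u by simp
  obtain m n :: int where mn: "?N u = of_int m" "?N ?v = of_int n" using int u v by meson
  have "?N u * ?N ?v = (cmod (ev \<chi> u * ev \<chi> ?v))\<^sup>2 * (cmod (ev \<psi> u * ev \<psi> ?v))\<^sup>2"
    by (simp add: norm_mult power_mult_distrib mult_ac)
  then have "of_int (m * n) = (1::real)"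
    using mn ev_unit_inverse[OF \<chi> u] ev_unit_inverse[OF \<psi> u] by simp
  then have "m * n = 1" by (metis of_int_eq_1_iff)
  moreover have "(of_int m :: real) \<ge> 0" by (simp flip: mn(1))
  then have "m \<ge> 0" by simp
  ultimately have "m = 1" using zmult_eq_1_iff by fastforce
  then have "(cmod (ev \<chi> u) * cmod (ev \<psi> u))\<^sup>2 = 1\<^sup>2" using mn(1) by (simp add: power_mult_distrib)
  then have "cmod (ev \<chi> u) * cmod (ev \<psi> u) = 1"
    by (subst (asm) power2_eq_iff_nonneg) simp_all
  then have "ln (cmod (ev \<chi> u) * cmod (ev \<psi> u)) = 0" by simp
  then show ?thesis
    using ev_unit_nonzero[OF \<chi> u] ev_unit_nonzero[OF \<psi> u] by (simp add: log_ev_def ln_mult)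
qed

text \<open>With \<open>s = t = 0\<close> the relation \<open>conj_rel\<close> says that both
  numbers are the same integer. Using \<open>\<chi>\<close> for both characters in
  \<open>unit_int_norm\<close> makes twice the logarithm 0.\<close>

lemma log_ev_rational:
  assumes \<chi>: "\<chi> \<in> characters" and u: "u \<in> Units ZG" and int: "\<And>x. x \<in> carrier G \<Longrightarrow> 2 * Re (\<chi> x) \<in> \<int>"
  shows "log_ev \<chi> u = 0"
proof -
  have rel: "conj_rel 0 0 (2 * Re (\<chi> x)) (2 * Re (\<chi> x))" if "x \<in> carrier G" for x
    using int[OF that] conj_rel_int by (metis Ints_cases)
  have "\<exists>n::int. (cmod (ev \<chi> v))\<^sup>2 * (cmod (ev \<chi> v))\<^sup>2 = of_int n" for v
    by (rule conj_rel_prod_int[OF _ _ conj_rel_ev[OF \<chi> \<chi> rel], where p = 0 and q = 0]) simp_all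
  then have "log_ev \<chi> u + log_ev \<chi> u = 0" using unit_int_norm[OF u \<chi> \<chi>] by blast
  then show ?thesis by simp
qed

text \<open>The traces \<open>a\<close> and \<open>b\<close> at the generator are roots of
  \<open>X^2 - p X - q\<close>. If they coincide, so do the absolute values. Otherwise they are the
  two roots, the product of the squared absolute values is an integer, and the logarithms are
  opposite.\<close>

lemma log_ev_quadratic:
  assumes \<chi>: "\<chi> \<in> characters" and \<psi>: "\<psi> \<in> characters" and u: "u \<in> Units ZG"
    and g: "g \<in> carrier G" "\<And>x. x \<in> carrier G \<Longrightarrow> \<exists>k::nat. x = g [^] k"
    and s: "(2 * Re (\<chi> g))\<^sup>2 = of_int p * (2 * Re (\<chi> g)) + of_int q"
    and t: "(2 * Re (\<psi> g))\<^sup>2 = of_int p * (2 * Re (\<psi> g)) + of_int q"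
  shows "\<bar>log_ev \<chi> u\<bar> = \<bar>log_ev \<psi> u\<bar>"
proof -
  define a b where "a = 2 * Re (\<chi> g)" and "b = 2 * Re (\<psi> g)"
  note st = s[folded a_def] t[folded b_def]
  have rel: "conj_rel a b (2 * Re (\<chi> x)) (2 * Re (\<psi> x))" if x: "x \<in> carrier G" for x
  proof -
    obtain k :: nat where "x = g [^] k" using g x by blast
    moreover have "conj_rel a b (2 * Re (\<chi> g ^ k)) (2 * Re (\<psi> g ^ k))"
      by (rule conj_rel_pow[OF st cmod_char[OF \<chi> g(1)] cmod_char[OF \<psi> g(1)]])
        (simp flip: a_def b_def add: conj_rel_base)
    ultimately show ?thesis using \<chi> \<psi> g(1) by (simp add: char_pow)
  qed
  show ?thesis
  proof (cases "a = b")
    case True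
    then have "(cmod (ev \<chi> u))\<^sup>2 = (cmod (ev \<psi> u))\<^sup>2"
      using conj_rel_ev[OF \<chi> \<psi> rel, of u] unfolding conj_rel_def True by metis
    then have "cmod (ev \<chi> u) = cmod (ev \<psi> u)" using power2_eq_imp_eq norm_ge_zero by blast
    then show ?thesis by (simp add: log_ev_def)
  next
    case False
    have "(a - b) * (a + b - of_int p) = 0" using st by (simp add: algebra_simps power2_eq_square)
    then have sum: "a + b = of_int p" using False by simp
    have "a * b = a * (of_int p - a)" using sum by (metis add_diff_cancel_left')
    also have "\<dots> = of_int (- q)" using st(1) by (simp add: algebra_simps power2_eq_square)
    finally have prod: "a * b = of_int (- q)" .
    have "\<exists>n::int. (cmod (ev \<chi> v))\<^sup>2 * (cmod (ev \<psi> v))\<^sup>2 = of_int n" for v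
      by (rule conj_rel_prod_int[OF sum prod conj_rel_ev[OF \<chi> \<psi> rel]])
    then have "log_ev \<chi> u + log_ev \<psi> u = 0" using unit_int_norm[OF u \<chi> \<psi>] by blast
    then show ?thesis by linarith
  qed
qed

text \<open>All traces are integers, so every logarithm vanishes and any character can serve as
  \<open>\<chi>0\<close>.\<close>

lemma ecut_small_exponent:
  assumes "(\<forall>x\<in>carrier G. x [^] (4::nat) = \<one>) \<or> (\<forall>x\<in>carrier G. x [^] (6::nat) = \<one>)"
  shows "ecut G"
proof (rule ecutI[OF char_trivial])
  fix \<chi> u assume \<chi>: "\<chi> \<in> characters" and u: "u \<in> Units ZG"
  have "\<chi> x ^ 4 = 1 \<or> \<chi> x ^ 6 = 1" if "x \<in> carrier G" for x
    using assms that char_pow[OF \<chi> that, symmetric] char_one[OF \<chi>] by metis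
  then have "log_ev \<chi> u = 0"
    using Re_root_of_unity(1,2) by (intro log_ev_rational[OF \<chi> u]) blast
  then show "log_ev \<chi> u = 0 \<or> \<bar>log_ev \<chi> u\<bar> = \<bar>log_ev (\<lambda>x. if x \<in> carrier G then 1 else 0) u\<bar>" ..
qed

text \<open>Characters with an integer trace at the generator contribute nothing. The traces of all
  others satisfy one fixed quadratic, so up to sign these characters share a single
  logarithm.\<close>

lemma ecut_small_cyclic:
  assumes cyc: "cyclic_group G" and n: "order G \<in> {5, 8, 12}"
  shows "ecut G"
proof -
  obtain g where g: "g \<in> carrier G" and gen: "carrier G = range (\<lambda>n::int. g [^] n)"
    using cyc cyclic_group by auto
  have gen': "\<exists>k::nat. x = g [^] k" if x: "x \<in> carrier G" for x
  proof -
    obtain i :: int where i: "x = g [^] i" using x gen by auto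
    have "int (ord g) > 0" using ord_ge_1[OF fin g] by simp
    then have "g [^] i = g [^] int (nat (i mod int (ord g)))"
      using g by (simp add: int_pow_eq flip: mod_eq_dvd_iff)
    also have "\<dots> = g [^] nat (i mod int (ord g))" by (rule int_pow_int)
    finally have "g [^] i = g [^] nat (i mod int (ord g))" .
    then show ?thesis using i by blast
  qed
  \<comment> \<open>The quadratics are \<open>X^2 + X - 1\<close>, \<open>X^2 - 2\<close> and
    \<open>X^2 - 3\<close> for the orders 5, 8 and 12.\<close>
  obtain p q :: int where pq: "\<And>z::complex. z ^ order G = 1 \<Longrightarrow> 2 * Re z \<in> \<int> \<or> (2 * Re z)\<^sup>2 = of_int p * (2 * Re z) + of_int q"
  proof -
    consider "order G = 5" | "order G = 8" | "order G = 12" using n by auto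
    then show ?thesis
    proof cases
      case 1 then show ?thesis using that[of "-1" 1] Re_root_of_unity(3) by simp
    next
      case 2 then show ?thesis using that[of 0 2] Re_root_of_unity(4) by simp
    next
      case 3 then show ?thesis using that[of 0 3] Re_root_of_unity(5) by simp
    qed
  qed
  have alt: "2 * Re (\<chi> g) \<in> \<int> \<or> (2 * Re (\<chi> g))\<^sup>2 = of_int p * (2 * Re (\<chi> g)) + of_int q"
    if "\<chi> \<in> characters" for \<chi>
    using that g by (intro pq) (simp add: char_pow[symmetric] pow_order_eq_1 char_one)
  have rat: "log_ev \<chi> u = 0" if \<chi>: "\<chi> \<in> characters" and u: "u \<in> Units ZG" and int: "2 * Re (\<chi> g) \<in> \<int>" for \<chi> u
  proof (rule log_ev_rational[OF \<chi> u])
    fix x assume "x \<in> carrier G"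
    then obtain k :: nat where k: "x = g [^] k" using gen' by blast
    have "conj_rel 0 0 (2 * Re (\<chi> g ^ k)) (2 * Re (\<chi> g ^ k))"
      by (rule conj_rel_pow[where p = 0 and q = 0]) (use int conj_rel_int cmod_char[OF \<chi> g] in \<open>auto elim!: Ints_cases\<close>)
    then show "2 * Re (\<chi> x) \<in> \<int>" using k \<chi> g by (auto simp: conj_rel_def char_pow)
  qed
  show ?thesis
  proof (cases "\<exists>\<chi>0\<in>characters. 2 * Re (\<chi>0 g) \<notin> \<int>")
    case True
    then obtain \<chi>0 where 0: "\<chi>0 \<in> characters" "2 * Re (\<chi>0 g) \<notin> \<int>" by blast
    show ?thesis
      using log_ev_quadratic[OF _ 0(1) _ g gen'] alt 0 rat by (intro ecutI[OF 0(1)]) blast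
  next
    case False
    then show ?thesis using rat by (intro ecutI[OF char_trivial]) blast
  qed
qed

end

section \<open>Bass units\<close>


lemma cis_power_eq_1_iff:
  fixes n k :: nat
  assumes "n > 0"
  shows "cis (2 * pi / n) ^ k = 1 \<longleftrightarrow> n dvd k"
proof
  let ?w = "cis (2 * pi / n)"
  have wn: "?w ^ n = 1" using assms by (simp add: DeMoivre)
  {
    assume "?w ^ k = 1"
    moreover have "?w ^ k = ?w ^ (n * (k div n) + k mod n)" by simp
    ultimately have "?w ^ (k mod n) = ?w ^ 0"
      unfolding power_add power_mult wn by simp
    then have "cis (2 * pi * real (k mod n) / real n) = cis (2 * pi * real 0 / real n)"
      by (simp add: DeMoivre mult.commute)
    then have "k mod n = 0"
      using inj_onD[OF bij_betw_imp_inj_on[OF bij_betw_roots_unity[OF assms]], of "k mod n" 0] assms by simp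
    then show "n dvd k" by auto
  }
  {
    assume "n dvd k"
    then show "?w ^ k = 1" using wn by (auto simp: dvd_def power_mult)
  }
qed

lemma power_coprime_eq_1:
  fixes z :: "'a :: comm_monoid_mult"
  assumes "coprime a b" "z ^ a = 1" "z ^ b = 1"
  shows "z = 1"
proof (cases "a = 0")
  case False
  obtain x y where "a * x = b * y + 1"
    using bezout_nat[OF False, of b] assms(1) by (auto simp: coprime_iff_gcd_eq_1)
  then have "z ^ (a * x) = z ^ (b * y) * z" by (simp add: power_add mult.commute)
  then show ?thesis using assms(2,3) by (simp add: power_mult)
qed (use assms in simp)

text \<open>On the unit circle \<open>(cmod (z - 1))\<^sup>2 = 2 - 2 * Re z\<close>, so the distance
  to 1 fixes the real part and leaves only the sign of the imaginary part.\<close>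

lemma cmod_diff_one_eq:
  fixes z w :: complex
  assumes "cmod z = 1" "cmod w = 1" "cmod (w - 1) = cmod (z - 1)"
  shows "w = z \<or> w = cnj z"
proof -
  have zz: "(Re z)\<^sup>2 + (Im z)\<^sup>2 = 1" "(Re w)\<^sup>2 + (Im w)\<^sup>2 = 1"
    using assms(1,2) by (simp_all flip: cmod_power2)
  have "(cmod (w - 1))\<^sup>2 = (cmod (z - 1))\<^sup>2" using assms(3) by simp
  then have "Re w = Re z"
    using zz by (simp add: cmod_power2 power2_diff)
  moreover from this have "(Im w)\<^sup>2 = (Im z)\<^sup>2" using zz by simp
  then have "Im w = Im z \<or> Im w = - Im z" by (simp add: power2_eq_iff)
  ultimately show ?thesis by (auto simp: complex_eq_iff)
qed

text \<open>The power is \<open>z\<close> or \<open>cnj z\<close>, the inverse of \<open>z\<close>,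
  by \<open>cmod_diff_one_eq\<close>. This tells when the logarithm of a Bass unit can
  vanish.\<close>

lemma cmod_power_diff_one_eq:
  fixes z :: complex
  assumes z: "cmod z = 1" and eq: "cmod (z ^ Suc k - 1) = cmod (z - 1)"
  shows "z ^ k = 1 \<or> z ^ Suc (Suc k) = 1"
proof -
  have "cmod (z ^ Suc k) = 1" using z by (simp add: norm_power norm_mult)
  then consider "z ^ Suc k = z" | "z ^ Suc k = cnj z" using cmod_diff_one_eq[OF z _ eq] by blast
  then show ?thesis
  proof cases
    case 1
    then have "z * z ^ k = z * 1" by simp
    then show ?thesis using z by (auto simp del: mult_1_right)
  next
    case 2
    have "z ^ Suc (Suc k) = z * cnj z" using 2 by simp
    also have "\<dots> = 1" using z by (simp flip: complex_norm_square)
    finally show ?thesis ..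
  qed
qed

lemma cmod_cis_diff_one_less_iff:
  "cmod (cis x - 1) < cmod (cis y - 1) \<longleftrightarrow> cos y < cos x"
proof -
  have sq: "(cmod (cis x - 1))\<^sup>2 = 2 - 2 * cos x" for x
    using sin_cos_squared_add[of x] by (simp add: cmod_power2 power2_diff)
  have "cmod (cis x - 1) < cmod (cis y - 1) \<longleftrightarrow> (cmod (cis x - 1))\<^sup>2 < (cmod (cis y - 1))\<^sup>2"
    using power_mono_iff[of "cmod (cis y - 1)" "cmod (cis x - 1)" 2] by (simp add: not_le[symmetric])
  then show ?thesis unfolding sq by simp
qed

text \<open>The distance of \<open>\<omega> ^ j\<close> from 1 increases for \<open>j\<close> up to
  \<open>a\<close>, the last exponent with angle below pi, and is unchanged when \<open>j\<close>
  becomes \<open>n - j\<close>. So \<open>\<omega>\<close> is nearest to 1 among the nontrivial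
  roots, \<open>\<omega> ^ a\<close> is farthest, and \<open>\<omega>\<^sup>2\<close> lies strictly
  between because \<open>a \<ge> 3\<close>.\<close>

lemma odd_roots_cmod:
  fixes n a :: nat
  defines "\<omega> \<equiv> cis (2 * pi / n)"
  assumes n: "n = 2 * a + 1" and a: "a \<ge> 3"
  shows "\<not> n dvd j \<Longrightarrow> cmod (\<omega> - 1) \<le> cmod (\<omega> ^ j - 1)"
    and "\<not> n dvd j \<Longrightarrow> cmod (\<omega> ^ j - 1) \<le> cmod (\<omega> ^ a - 1)"
    and "cmod (\<omega> - 1) < cmod (\<omega> ^ 2 - 1)" and "cmod (\<omega> ^ 2 - 1) < cmod (\<omega> ^ a - 1)"
    and "cmod (\<omega> ^ (2 * a) - 1) = cmod (\<omega> - 1)"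
proof -
  have n0: "n > 0" using n by simp
  have pw: "\<omega> ^ j = cis (2 * pi * j / n)" for j by (simp add: \<omega>_def DeMoivre mult_ac)
  have \<omega>n: "\<omega> ^ n = 1" using n0 by (simp add: \<omega>_def DeMoivre)
  have mono: "cmod (\<omega> ^ i - 1) < cmod (\<omega> ^ j - 1)" if "i < j" "j \<le> a" for i j
  proof -
    have "2 * pi * i / n < 2 * pi * j / n" using that n0 by (simp add: divide_strict_right_mono)
    moreover have "2 * real j \<le> real n" using that n by simp
    then have "2 * pi * j / n \<le> pi" using n0 by (simp add: pos_divide_le_eq)
    ultimately show ?thesis unfolding pw cmod_cis_diff_one_less_iff
      by (intro cos_monotone_0_pi) (use n0 in auto)
  qed
  have mono': "cmod (\<omega> ^ i - 1) \<le> cmod (\<omega> ^ j - 1)" if "i \<le> j" "j \<le> a" for i j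
    using mono[of i j] that by (cases "i = j") auto
  have refl: "cmod (\<omega> ^ (n - j) - 1) = cmod (\<omega> ^ j - 1)" if "j \<le> n" for j
  proof -
    have "\<omega> ^ j * (\<omega> ^ (n - j) - 1) = 1 - \<omega> ^ j"
      using that \<omega>n by (simp add: algebra_simps flip: power_add)
    then have "cmod (\<omega> ^ j) * cmod (\<omega> ^ (n - j) - 1) = cmod (\<omega> ^ j - 1)"
      by (metis norm_minus_commute norm_mult)
    then show ?thesis by (simp add: pw)
  qed
  have main: "cmod (\<omega> ^ 1 - 1) \<le> cmod (\<omega> ^ j - 1) \<and> cmod (\<omega> ^ j - 1) \<le> cmod (\<omega> ^ a - 1)"
    if j: "\<not> n dvd j" for j
  proof -
    define i where "i = j mod n"
    have "\<omega> ^ j = \<omega> ^ (n * (j div n) + i)" by (simp add: i_def)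
    also have "\<dots> = \<omega> ^ i" unfolding power_add power_mult \<omega>n by simp
    finally have eq: "\<omega> ^ j = \<omega> ^ i" .
    have i: "0 < i" "i < n" using j n0 by (auto simp: i_def mod_greater_zero_iff_not_dvd)
    show ?thesis
    proof (cases "i \<le> a")
      case True
      then show ?thesis unfolding eq using mono'[of 1 i] mono'[of i a] i by simp
    next
      case False
      then have "1 \<le> n - i" "n - i \<le> a" using i n by auto
      then show ?thesis unfolding eq using mono'[of 1 "n - i"] mono'[of "n - i" a] refl[of i] i by simp
    qed
  qed
  show "\<not> n dvd j \<Longrightarrow> cmod (\<omega> - 1) \<le> cmod (\<omega> ^ j - 1)"
    "\<not> n dvd j \<Longrightarrow> cmod (\<omega> ^ j - 1) \<le> cmod (\<omega> ^ a - 1)"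
    using main by auto
  show "cmod (\<omega> - 1) < cmod (\<omega> ^ 2 - 1)" using mono[of 1 2] a by simp
  show "cmod (\<omega> ^ 2 - 1) < cmod (\<omega> ^ a - 1)" using mono[of 2 a] a by simp
  show "cmod (\<omega> ^ (2 * a) - 1) = cmod (\<omega> - 1)" using refl[of 1] n by simp
qed

section \<open>Construction of units from formulas in the character values\<close>

context finite_comm_group
begin

text \<open>These functions agree on \<open>characters\<close> with the evaluations of an element of
  \<open>ZG\<close>. Units are built by giving such a function and its inverse, without handling
  coefficients.\<close>

definition realizable :: "(('a \<Rightarrow> complex) \<Rightarrow> complex) \<Rightarrow> bool" where
  "realizable F \<longleftrightarrow> (\<exists>f\<in>carrier ZG. \<forall>\<chi>\<in>characters. ev \<chi> f = F \<chi>)"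

lemma realizable_ev: "f \<in> carrier ZG \<Longrightarrow> realizable (\<lambda>\<chi>. ev \<chi> f)"
  by (auto simp: realizable_def)

lemma realizable_add: "realizable E \<Longrightarrow> realizable F \<Longrightarrow> realizable (\<lambda>\<chi>. E \<chi> + F \<chi>)"
  unfolding realizable_def
  by (elim bexE, rule_tac x = "f \<oplus>\<^bsub>ZG\<^esub> fa" in bexI) (simp_all add: ev_add)

lemma realizable_mult: "realizable E \<Longrightarrow> realizable F \<Longrightarrow> realizable (\<lambda>\<chi>. E \<chi> * F \<chi>)"
  unfolding realizable_def
  by (elim bexE, rule_tac x = "f \<otimes>\<^bsub>ZG\<^esub> fa" in bexI) (simp_all add: ev_mult)

lemma realizable_int: "realizable (\<lambda>_. of_int k)"
  unfolding realizable_def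
  by (intro bexI[of _ "\<lambda>x. k * \<one>\<^bsub>ZG\<^esub> x"])
    (use ZG.one_closed in \<open>auto simp: ev_scale ev_one carrier_ZG\<close>)

lemma realizable_uminus: "realizable F \<Longrightarrow> realizable (\<lambda>\<chi>. - F \<chi>)"
  using realizable_mult[OF realizable_int[of "-1"]] by simp

lemma realizable_char: "g \<in> carrier G \<Longrightarrow> realizable (\<lambda>\<chi>. \<chi> g)"
  unfolding realizable_def
  by (intro bexI[of _ "group_element g"]) (simp_all add: group_element_closed ev_group_element)

lemma realizable_power: "realizable F \<Longrightarrow> realizable (\<lambda>\<chi>. F \<chi> ^ n)"
  by (induction n) (use realizable_int[of 1] in \<open>auto intro: realizable_mult\<close>)

lemma realizable_sum: "(\<And>i. i < n \<Longrightarrow> realizable (F i)) \<Longrightarrow> realizable (\<lambda>\<chi>. \<Sum>i<n. F i \<chi>)"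
  for n :: nat
  by (induction n) (use realizable_int[of 0] in \<open>auto intro: realizable_add\<close>)

lemma realizable_unit:
  assumes "realizable E" "realizable F" "\<And>\<chi>. \<chi> \<in> characters \<Longrightarrow> E \<chi> * F \<chi> = 1"
  shows "\<exists>u\<in>Units ZG. \<forall>\<chi>\<in>characters. ev \<chi> u = E \<chi>"
proof -
  obtain e f where ef: "e \<in> carrier ZG" "\<forall>\<chi>\<in>characters. ev \<chi> e = E \<chi>"
    "f \<in> carrier ZG" "\<forall>\<chi>\<in>characters. ev \<chi> f = F \<chi>"
    using assms(1,2) unfolding realizable_def by blast
  then have "e \<in> Units ZG" using assms(3) by (intro unitI[OF ef(1,3)]) simp
  then show ?thesis using ef(2) by blast
qed

text \<open>For \<open>\<chi> h \<noteq> 1\<close> the element \<open>1 + h + ... + h^(k-1)\<close>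
  has the value \<open>(\<chi> h ^ k - 1) / (\<chi> h - 1)\<close>, and the analogous sum for
  \<open>h^k\<close> and an inverse \<open>k'\<close> of \<open>k\<close> modulo the order has the
  reciprocal value. For \<open>\<chi> h = 1\<close> the values are \<open>k\<close> and
  \<open>k'\<close>; after raising to the power \<open>e\<close>, a multiple of the sum of all
  powers of \<open>h\<close> corrects them to 1 and changes no other value.\<close>

lemma bass_unit:
  assumes h: "h \<in> carrier G" and k: "coprime k (ord h)"
  shows "\<exists>u\<in>Units ZG. \<forall>\<chi>\<in>characters. \<chi> h \<noteq> 1 \<longrightarrow>
    log_ev \<chi> u = totient (ord h) * (ln (cmod (\<chi> h ^ k - 1)) - ln (cmod (\<chi> h - 1)))"
proof -
  define n where "n = ord h"
  define e where "e = totient n"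
  define k' where "k' = k ^ (e - 1)"
  have n0: "n > 0" using ord_ge_1[OF fin h] by (simp add: n_def)
  then have e0: "e > 0" by (simp add: e_def)
  have ke: "[k ^ e = 1] (mod n)" using euler_theorem[of k n] k by (simp add: e_def n_def)
  have kk': "k * k' = k ^ e" using e0 by (simp add: k'_def flip: power_Suc)
  have k'e: "[k' ^ e = 1] (mod n)"
  proof -
    have "k' ^ e = (k ^ e) ^ (e - 1)" by (simp add: k'_def mult.commute flip: power_mult)
    then show ?thesis using cong_pow[OF ke, of "e - 1"] by simp
  qed
  have ex: "\<exists>s::int. 1 - int (m ^ e) = s * int n" if "[m ^ e = 1] (mod n)" for m
  proof -
    have "int n dvd 1 - int (m ^ e)"
      using that by (metis cong_iff_dvd_diff cong_int_iff cong_sym of_nat_1)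
    then show ?thesis by (metis dvd_def mult.commute)
  qed
  \<comment> \<open>The correction has integer coefficients because \<open>k ^ e\<close> and
    \<open>k' ^ e\<close> are 1 modulo \<open>n\<close>.\<close>
  obtain s s' :: int where s: "1 - int (k ^ e) = s * int n" and s': "1 - int (k' ^ e) = s' * int n"
    using ex[OF ke] ex[OF k'e] by blast
  have "of_int (1 - int (k ^ e)) = (of_int (s * int n) :: complex)" unfolding s ..
  then have sc: "of_nat k ^ e + of_int s * of_nat n = (1 :: complex)" by (simp add: algebra_simps)
  have "of_int (1 - int (k' ^ e)) = (of_int (s' * int n) :: complex)" unfolding s' ..
  then have sc': "of_nat k' ^ e + of_int s' * of_nat n = (1 :: complex)" by (simp add: algebra_simps)
  define E where "E \<chi> = (\<Sum>i<k. \<chi> h ^ i) ^ e + of_int s * (\<Sum>i<n. \<chi> h ^ i)" for \<chi> :: "'a \<Rightarrow> complex"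
  define F where "F \<chi> = (\<Sum>i<k'. (\<chi> h ^ k) ^ i) ^ e + of_int s' * (\<Sum>i<n. \<chi> h ^ i)" for \<chi> :: "'a \<Rightarrow> complex"
  have realE: "realizable E" and realF: "realizable F"
    unfolding E_def F_def
    by (intro realizable_add realizable_mult realizable_power realizable_sum realizable_int realizable_char h)+
  have Ev: "E \<chi> = ((\<chi> h ^ k - 1) / (\<chi> h - 1)) ^ e" and Fv: "F \<chi> = ((\<chi> h - 1) / (\<chi> h ^ k - 1)) ^ e"
    and nz: "\<chi> h ^ k \<noteq> 1"
    if \<chi>: "\<chi> \<in> characters" and ne: "\<chi> h \<noteq> 1" for \<chi>
  proof -
    have zn: "\<chi> h ^ n = 1" using char_pow_ord[OF \<chi> h] by (simp add: n_def)
    have zkk: "\<chi> h ^ (k * k') = \<chi> h"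
    proof -
      have "\<chi> h ^ (k * k') = \<chi> h ^ (n * ((k * k') div n) + (k * k') mod n)" by simp
      also have "\<dots> = \<chi> h ^ ((k * k') mod n)" unfolding power_add power_mult zn by simp
      also have "(k * k') mod n = 1 mod n" using ke by (simp add: kk' cong_def)
      also have "\<chi> h ^ (1 mod n) = \<chi> h"
        using zn ne n0 by (cases "n = 1") auto
      finally show ?thesis .
    qed
    show nz: "\<chi> h ^ k \<noteq> 1"
      using power_coprime_eq_1[of k n "\<chi> h"] k zn ne by (auto simp: n_def)
    have "(\<Sum>i<n. \<chi> h ^ i) = 0" using zn ne by (simp add: geometric_sum)
    moreover have "(\<Sum>i<k'. (\<chi> h ^ k) ^ i) = (\<chi> h - 1) / (\<chi> h ^ k - 1)"
      using geometric_sum[OF nz, of k'] zkk[unfolded power_mult] by (simp only:)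
    ultimately show "E \<chi> = ((\<chi> h ^ k - 1) / (\<chi> h - 1)) ^ e" "F \<chi> = ((\<chi> h - 1) / (\<chi> h ^ k - 1)) ^ e"
      using ne by (simp_all add: E_def F_def geometric_sum)
  qed
  have one: "E \<chi> * F \<chi> = 1" if \<chi>: "\<chi> \<in> characters" for \<chi>
  proof (cases "\<chi> h = 1")
    case True
    then show ?thesis using sc sc' by (simp add: E_def F_def)
  next
    case False
    then show ?thesis using nz[OF \<chi>] by (simp add: Ev[OF \<chi>] Fv[OF \<chi>] flip: power_mult_distrib)
  qed
  obtain u where u: "u \<in> Units ZG" "\<forall>\<chi>\<in>characters. ev \<chi> u = E \<chi>"
    using realizable_unit[OF realE realF one] by blast
  have "log_ev \<chi> u = totient (ord h) * (ln (cmod (\<chi> h ^ k - 1)) - ln (cmod (\<chi> h - 1)))"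
    if \<chi>: "\<chi> \<in> characters" and ne: "\<chi> h \<noteq> 1" for \<chi>
  proof -
    have "log_ev \<chi> u = ln ((cmod (\<chi> h ^ k - 1) / cmod (\<chi> h - 1)) ^ e)"
      using u(2) \<chi> Ev[OF \<chi> ne] by (simp add: log_ev_def norm_power norm_divide)
    also have "\<dots> = e * (ln (cmod (\<chi> h ^ k - 1)) - ln (cmod (\<chi> h - 1)))"
      using ne nz[OF \<chi> ne] by (simp add: ln_realpow ln_div)
    finally show ?thesis by (simp add: e_def n_def)
  qed
  then show ?thesis using u(1) by blast
qed

text \<open>For \<open>n = 2 a + 1\<close> the Bass units with exponents 2 and \<open>a\<close> are
  compared at \<open>\<chi>\<close> and at its \<open>a\<close>-th power. As \<open>2 a\<close> is
  -1 modulo \<open>n\<close>, \<open>f (2 * a) = f 1\<close>, and proportionality becomes an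
  equation between \<open>f 1\<close>, \<open>f 2\<close>, \<open>f a\<close> and
  \<open>f (a * a)\<close>. It contradicts \<open>f 1 < f 2 < f a\<close> and
  \<open>f 1 \<le> f (a * a)\<close>.\<close>

lemma ecut_imp_odd_order_less:
  assumes ecut: "ecut G" and h: "h \<in> carrier G" and odd: "odd (ord h)"
  shows "ord h < 7"
proof (rule ccontr)
  assume "\<not> ord h < 7"
  define n where "n = ord h"
  obtain a where a: "n = 2 * a + 1" using odd by (auto simp: n_def elim: oddE)
  have a3: "a \<ge> 3" using \<open>\<not> ord h < 7\<close> a by (simp add: n_def)
  define \<omega> where "\<omega> = cis (2 * pi / n)"
  define f where "f j = ln (cmod (\<omega> ^ j - 1))" for j
  note roots = odd_roots_cmod[OF a a3, folded \<omega>_def]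
  have n0: "n > 0" using a by simp
  have pos: "cmod (\<omega> ^ j - 1) > 0" if "\<not> n dvd j" for j
    using cis_power_eq_1_iff[OF n0, of j] that by (simp add: \<omega>_def)
  have cop2: "coprime 2 n" using a by simp
  have copa: "coprime a n" using a by (metis coprime_add_one_right coprime_mult_left_iff coprime_commute mult.commute)
  have nd: "\<not> n dvd 1" "\<not> n dvd 2" "\<not> n dvd a" "\<not> n dvd a * a" "\<not> n dvd 2 * a"
  proof -
    show "\<not> n dvd 1" "\<not> n dvd 2" "\<not> n dvd a" "\<not> n dvd 2 * a" using a a3 by (auto dest: dvd_imp_le)
    then show "\<not> n dvd a * a" using copa by (simp add: coprime_commute coprime_dvd_mult_right_iff)
  qed
  have f1: "f (a * a) \<ge> f 1" "f 2 > f 1" "f a > f 2" "f (2 * a) = f 1"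
    unfolding f_def using roots(1)[OF nd(4)] roots(3,4,5) pos[OF nd(1)] pos[OF nd(2)] pos[OF nd(3)] pos[OF nd(4)]
    by (simp_all add: ln_le_cancel_iff ln_less_cancel_iff)
  obtain \<chi> where \<chi>: "\<chi> \<in> characters" "\<chi> h = \<omega>"
    using character_exists[OF h] by (auto simp: \<omega>_def n_def)
  define \<psi> where "\<psi> = (\<lambda>x. if x \<in> carrier G then \<chi> x ^ a else 0)"
  have \<psi>: "\<psi> \<in> characters" "\<psi> h = \<omega> ^ a" using char_power[OF \<chi>(1)] \<chi>(2) h by (auto simp: \<psi>_def)
  have ne: "\<chi> h \<noteq> 1" "\<psi> h \<noteq> 1" using pos[OF nd(1)] pos[OF nd(3)] \<chi> \<psi> by auto
  obtain u v where u: "u \<in> Units ZG" "\<forall>\<chi>\<in>characters. \<chi> h \<noteq> 1 \<longrightarrow>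
      log_ev \<chi> u = totient n * (ln (cmod (\<chi> h ^ 2 - 1)) - ln (cmod (\<chi> h - 1)))"
    and v: "v \<in> Units ZG" "\<forall>\<chi>\<in>characters. \<chi> h \<noteq> 1 \<longrightarrow>
      log_ev \<chi> v = totient n * (ln (cmod (\<chi> h ^ a - 1)) - ln (cmod (\<chi> h - 1)))"
    using bass_unit[OF h, of 2] bass_unit[OF h, of a] cop2 copa unfolding n_def by blast
  define e where "e = real (totient n)"
  have e: "e > 0" using n0 by (simp add: e_def)
  have "log_ev \<chi> u = e * (f 2 - f 1)" "log_ev \<chi> v = e * (f a - f 1)"
    "log_ev \<psi> u = e * (f (2 * a) - f a)" "log_ev \<psi> v = e * (f (a * a) - f a)"
    using u(2) v(2) \<chi> \<psi> ne by (simp_all add: f_def e_def mult.commute flip: power_mult)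
  then have "(e * e) * ((f 2 - f 1) * (f (a * a) - f a)) = (e * e) * ((f 1 - f a) * (f a - f 1))"
    using log_ev_proportional[OF ecut \<chi>(1) \<psi>(1) u(1) v(1)] f1(4) by (simp add: mult_ac)
  then have eq: "(f 2 - f 1) * (f (a * a) - f a) = (f 1 - f a) * (f a - f 1)" using e by simp
  have "(f 2 - f 1) * (f 1 - f a) \<le> (f 2 - f 1) * (f (a * a) - f a)"
    using f1 by (intro mult_left_mono) auto
  also note eq
  also have "(f 1 - f a) * (f a - f 1) < (f 1 - f a) * (f 2 - f 1)"
    using f1 by (intro mult_strict_left_mono_neg) auto
  finally show False by (simp add: mult.commute)
qed

text \<open>If \<open>u\<^sup>m = 1 + q y\<close> with \<open>q\<close> the order of \<open>t\<close>, take \<open>v = 1 + y (1 + t + \<dots> + t\<^sup>q\<^sup>-\<^sup>1)\<close>.\<close>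

lemma isolate_unit:
  assumes u: "u \<in> Units ZG" and t: "t \<in> carrier G"
  shows "\<exists>v\<in>Units ZG. \<exists>m>0. \<forall>\<chi>\<in>characters. log_ev \<chi> v = (if \<chi> t = 1 then real m * log_ev \<chi> u else 0)"
proof -
  define q where "q = ord t"
  have q0: "q > 0" using ord_ge_1[OF fin t] by (simp add: q_def)
  \<comment> \<open>\<open>r i\<close> reduces the \<open>i\<close>-th power of \<open>u\<close>
    modulo \<open>q\<close>. There are finitely many reductions, so two powers of \<open>u\<close>
    agree modulo \<open>q\<close>.\<close>
  define r where "r i x = (if x \<in> carrier G then (u [^]\<^bsub>ZG\<^esub> (i::nat)) x mod int q else 0)" for i x
  have "range r \<subseteq> {f. \<forall>x. (x \<in> carrier G \<longrightarrow> f x \<in> {0..int q}) \<and> (x \<notin> carrier G \<longrightarrow> f x = 0)}"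
    using q0 by (auto simp: r_def less_imp_le)
  then have "finite (range r)"
    using finite_set_of_finite_funs[OF fin finite_atLeastAtMost_int, of 0 "int q" 0] by (rule finite_subset)
  then have "\<not> inj r" using finite_imageD infinite_UNIV_nat by blast
  then obtain i j where ij: "i < j" "r i = r j"
    unfolding inj_def by (metis nat_neq_iff)
  define m where "m = j - i"
  have uc: "u \<in> carrier ZG" using u by (rule ZG.Units_closed)
  \<comment> \<open>Here \<open>q\<close> times \<open>y\<close> is the difference of the two
    powers. Division by the lower power is done on values, in \<open>Y\<close>, so that
    \<open>1 + q Y\<close> is the value of \<open>u^m\<close>.\<close>
  define y where "y x = ((u [^]\<^bsub>ZG\<^esub> j) x - (u [^]\<^bsub>ZG\<^esub> i) x) div int q" for x
  have uj: "(u [^]\<^bsub>ZG\<^esub> j) x = (u [^]\<^bsub>ZG\<^esub> i) x + int q * y x" if "x \<in> carrier G" for x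
  proof -
    have "(u [^]\<^bsub>ZG\<^esub> j) x mod int q = (u [^]\<^bsub>ZG\<^esub> i) x mod int q"
      using fun_cong[OF ij(2), of x] that by (simp add: r_def)
    then have "int q dvd (u [^]\<^bsub>ZG\<^esub> j) x - (u [^]\<^bsub>ZG\<^esub> i) x" by (simp add: mod_eq_dvd_iff)
    then show ?thesis by (simp add: y_def)
  qed
  have yc: "y \<in> carrier ZG"
    using uc ZG.nat_pow_closed[OF uc] by (auto simp: carrier_ZG y_def)
  have evpow: "ev \<chi> (u [^]\<^bsub>ZG\<^esub> (k::nat)) = ev \<chi> u ^ k" if "\<chi> \<in> characters" for \<chi> k
    using that by (induction k) (simp_all add: ev_one ev_mult)
  define w where "w = inv\<^bsub>ZG\<^esub> u"
  have wc: "w \<in> carrier ZG" using u by (simp add: w_def)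
  have uw: "ev \<chi> u * ev \<chi> w = 1" if "\<chi> \<in> characters" for \<chi>
    using ev_unit_inverse[OF that u] by (simp add: w_def)
  define Y where "Y \<chi> = ev \<chi> y * ev \<chi> w ^ i" for \<chi>
  have Y: "1 + of_nat q * Y \<chi> = ev \<chi> u ^ m" if \<chi>: "\<chi> \<in> characters" for \<chi>
  proof -
    have "ev \<chi> (u [^]\<^bsub>ZG\<^esub> j) = ev \<chi> (u [^]\<^bsub>ZG\<^esub> i) + of_nat q * ev \<chi> y"
      by (simp add: ev_def uj distrib_right sum.distrib sum_distrib_left mult.assoc)
    then have "ev \<chi> u ^ (m + i) = ev \<chi> u ^ i + of_nat q * ev \<chi> y"
      using ij(1) by (simp add: evpow[OF \<chi>] m_def)
    then have "ev \<chi> u ^ (m + i) * ev \<chi> w ^ i = (ev \<chi> u ^ i + of_nat q * ev \<chi> y) * ev \<chi> w ^ i"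
      by simp
    then have "ev \<chi> u ^ m * (ev \<chi> u * ev \<chi> w) ^ i = (ev \<chi> u * ev \<chi> w) ^ i + of_nat q * Y \<chi>"
      unfolding power_add power_mult_distrib distrib_right Y_def mult.assoc .
    then show ?thesis using uw[OF \<chi>] by simp
  qed
  \<comment> \<open>Where \<open>t\<close> is killed, the value \<open>q\<close> of \<open>T\<close>
    turns \<open>1 + Y T\<close> into the value of \<open>u^m\<close>; elsewhere the value 0 turns
    it into 1.\<close>
  define T where "T \<chi> = (\<Sum>i<q. \<chi> t ^ i)" for \<chi> :: "'a \<Rightarrow> complex"
  have T: "T \<chi> = (if \<chi> t = 1 then of_nat q else 0)" if \<chi>: "\<chi> \<in> characters" for \<chi>
    using char_pow_ord[OF \<chi> t] by (simp add: T_def geometric_sum q_def)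
  have Yr: "realizable Y" unfolding Y_def
    by (intro realizable_mult realizable_power realizable_ev yc wc)
  have Tr: "realizable T" unfolding T_def
    by (intro realizable_sum realizable_power realizable_char t)
  have one: "realizable (\<lambda>_. 1)" using realizable_int[of 1] by simp
  note real = realizable_add[OF one realizable_mult[OF Yr Tr]]
    realizable_add[OF one realizable_mult[OF realizable_uminus[OF realizable_mult[OF Yr
      realizable_power[OF realizable_ev[OF wc], of m]]] Tr]]
  \<comment> \<open>The second factor inverts the first: where \<open>t\<close> is killed it is
    \<open>1 - q Y u^(-m) = u^(-m)\<close>.\<close>
  have "(1 + Y \<chi> * T \<chi>) * (1 + (- (Y \<chi> * ev \<chi> w ^ m)) * T \<chi>) = 1" if \<chi>: "\<chi> \<in> characters" for \<chi>
  proof (cases "\<chi> t = 1")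
    case True
    have "1 + Y \<chi> * T \<chi> = ev \<chi> u ^ m" using True T[OF \<chi>] Y[OF \<chi>] by (simp add: mult.commute)
    moreover have uwm: "ev \<chi> u ^ m * ev \<chi> w ^ m = 1" using uw[OF \<chi>] by (simp flip: power_mult_distrib)
    moreover have "1 + (- (Y \<chi> * ev \<chi> w ^ m)) * T \<chi> = 1 - (ev \<chi> u ^ m - 1) * ev \<chi> w ^ m"
      unfolding calculation(1)[symmetric] by (simp add: mult_ac)
    ultimately show ?thesis by (simp add: left_diff_distrib)
  qed (use T[OF \<chi>] in simp)
  then obtain v where v: "v \<in> Units ZG" "\<forall>\<chi>\<in>characters. ev \<chi> v = 1 + Y \<chi> * T \<chi>"
    using realizable_unit[OF real] by blast
  have "log_ev \<chi> v = (if \<chi> t = 1 then real m * log_ev \<chi> u else 0)" if \<chi>: "\<chi> \<in> characters" for \<chi>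
  proof (cases "\<chi> t = 1")
    case True
    have "ev \<chi> v = ev \<chi> u ^ m" using v(2) \<chi> True T[OF \<chi>] Y[OF \<chi>] by (simp add: mult.commute)
    then show ?thesis using True ev_unit_nonzero[OF \<chi> u] by (simp add: log_ev_def norm_power ln_realpow)
  next
    case False
    then show ?thesis using v(2) \<chi> T[OF \<chi>] by (simp add: log_ev_def)
  qed
  moreover have "m > 0" using ij(1) by (simp add: m_def)
  ultimately show ?thesis using v(1) by blast
qed

end

section \<open>Characters of large order\<close>


lemma divisors_8_12_cases:
  fixes n :: nat
  assumes "n > 0" "\<not> n dvd 4" "\<not> n dvd 6" and even: "even n \<Longrightarrow> n dvd 8 \<or> n dvd 12" and odd: "odd n \<Longrightarrow> n < 7"
  shows "n \<in> {5, 8, 12}"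
proof -
  have "n \<le> 12" using even odd by (cases "even n") (auto dest: dvd_imp_le)
  then have "n \<in> {1..12}" using assms(1) by simp
  then have "n \<in> {1, 2, 3, 4, 5, 6, 7, 8, 9, 10, 11, 12}" by (auto simp: numeral_eq_Suc le_Suc_eq)
  then show ?thesis using assms by auto
qed

context finite_comm_group
begin

text \<open>As the image of a character is cyclic, this says that its order divides neither 4 nor 6.\<close>

definition big :: "('a \<Rightarrow> complex) \<Rightarrow> bool" where
  "big \<chi> \<longleftrightarrow> \<chi> \<in> characters \<and> (\<exists>h\<in>carrier G. \<chi> h ^ 4 \<noteq> 1 \<and> \<chi> h ^ 6 \<noteq> 1)"

text \<open>Two elements violating one identity each would have a product violating both: a group is
  not the union of two proper subgroups.\<close>

lemma not_bigD:
  assumes \<chi>: "\<chi> \<in> characters" and nb: "\<not> big \<chi>"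
  shows "(\<forall>x\<in>carrier G. \<chi> x ^ 4 = 1) \<or> (\<forall>x\<in>carrier G. \<chi> x ^ 6 = 1)"
proof (rule ccontr)
  assume "\<not> ?thesis"
  then obtain x y where xy: "x \<in> carrier G" "\<chi> x ^ 4 \<noteq> 1" "y \<in> carrier G" "\<chi> y ^ 6 \<noteq> 1" by blast
  have all: "\<chi> z ^ 4 = 1 \<or> \<chi> z ^ 6 = 1" if "z \<in> carrier G" for z
    using nb \<chi> that by (auto simp: big_def)
  have "\<chi> x ^ 6 = 1" "\<chi> y ^ 4 = 1" using all xy by blast+
  then have "\<chi> (x \<otimes> y) ^ 4 = \<chi> x ^ 4" "\<chi> (x \<otimes> y) ^ 6 = \<chi> y ^ 6"
    using xy \<chi> by (simp_all add: char_mult power_mult_distrib)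
  then show False using all[of "x \<otimes> y"] xy by simp
qed

text \<open>As in \<open>not_bigD\<close>, a product argument gives one \<open>h\<close> violating
  both identities, and a character faithful on the powers of \<open>h\<close> detects this.\<close>

lemma big_exists:
  assumes "\<not> (\<forall>x\<in>carrier G. x [^] (4::nat) = \<one>)" "\<not> (\<forall>x\<in>carrier G. x [^] (6::nat) = \<one>)"
  shows "\<exists>\<chi>. big \<chi>"
proof -
  obtain x y where xy: "x \<in> carrier G" "x [^] (4::nat) \<noteq> \<one>" "y \<in> carrier G" "y [^] (6::nat) \<noteq> \<one>"
    using assms by blast
  have "\<exists>h\<in>carrier G. h [^] (4::nat) \<noteq> \<one> \<and> h [^] (6::nat) \<noteq> \<one>"
  proof (rule ccontr)
    assume "\<not> ?thesis"
    then have all: "z [^] (4::nat) = \<one> \<or> z [^] (6::nat) = \<one>" if "z \<in> carrier G" for z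
      using that by blast
    have "x [^] (6::nat) = \<one>" "y [^] (4::nat) = \<one>" using all xy by blast+
    then have "(x \<otimes> y) [^] (4::nat) = x [^] (4::nat)" "(x \<otimes> y) [^] (6::nat) = y [^] (6::nat)"
      using xy by (simp_all add: nat_pow_distrib)
    then show False using all[of "x \<otimes> y"] xy by simp
  qed
  then obtain h where h: "h \<in> carrier G" "h [^] (4::nat) \<noteq> \<one>" "h [^] (6::nat) \<noteq> \<one>" by blast
  obtain \<chi> where \<chi>: "\<chi> \<in> characters" "\<chi> h = cis (2 * pi / ord h)"
    using character_exists[OF h(1)] by blast
  have "ord h > 0" using ord_ge_1[OF fin h(1)] by simp
  then have "\<chi> h ^ 4 \<noteq> 1 \<and> \<chi> h ^ 6 \<noteq> 1"
    using h unfolding \<chi>(2) by (simp add: cis_power_eq_1_iff pow_eq_id)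
  then show ?thesis using \<chi>(1) h(1) by (auto simp: big_def)
qed

text \<open>A Bass unit of \<open>h\<close> with exponent 5 or 3 works: by
  \<open>cmod_power_diff_one_eq\<close> its logarithm at \<open>\<chi>\<close> could vanish only if
  the order of \<open>\<chi> h\<close> divided 4 or 6, respectively 2 or 4. One of 3 and 5 is
  coprime to the order of \<open>h\<close>, since \<open>ecut_imp_odd_order_less\<close> excludes an
  element of order 15.\<close>

lemma big_unit:
  assumes "ecut G" and "big \<chi>"
  shows "\<exists>u\<in>Units ZG. log_ev \<chi> u \<noteq> 0"
proof -
  have \<chi>: "\<chi> \<in> characters" using assms(2) by (simp add: big_def)
  obtain h where h: "h \<in> carrier G" and z: "\<chi> h ^ 4 \<noteq> 1" "\<chi> h ^ 6 \<noteq> 1"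
    using assms(2) by (auto simp: big_def)
  have z1: "cmod (\<chi> h) = 1" using \<chi> h by (rule cmod_char)
  have z2: "\<chi> h ^ 2 \<noteq> 1"
  proof
    assume "\<chi> h ^ 2 = 1"
    then have "(\<chi> h ^ 2) ^ 2 = 1" by (simp only: power_one)
    then show False using z(1) by (simp flip: power_mult)
  qed
  then have ne: "\<chi> h \<noteq> 1" by auto
  have "\<not> 15 dvd ord h"
  proof
    assume d: "15 dvd ord h"
    have o: "ord h > 0" using ord_ge_1[OF fin h] by simp
    define x where "x = h [^] (ord h div 15)"
    have x: "x \<in> carrier G" using h by (simp add: x_def)
    have iff: "x [^] k = \<one> \<longleftrightarrow> 15 dvd k" for k :: nat
    proof -
      obtain m where m: "ord h = 15 * m" using d by (elim dvdE)
      then have "x [^] k = h [^] (m * k)" using h by (simp add: x_def nat_pow_pow)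
      then have "x [^] k = \<one> \<longleftrightarrow> 15 * m dvd m * k" using pow_eq_id[OF h] m by simp
      then show ?thesis using m o by (simp add: mult.commute)
    qed
    have "ord x = 15" using iff pow_eq_id[OF x] by (metis dvd_antisym dvd_refl)
    then show False using ecut_imp_odd_order_less[OF assms(1) x] by simp
  qed
  then have "\<not> 5 dvd ord h \<or> \<not> 3 dvd ord h"
    by presburger
  then obtain k where k: "coprime k (ord h)" and ne_k: "cmod (\<chi> h ^ k - 1) \<noteq> cmod (\<chi> h - 1)"
  proof
    assume "\<not> 5 dvd ord h"
    then have "coprime 5 (ord h)" by (intro prime_imp_coprime) simp_all
    moreover have "cmod (\<chi> h ^ 5 - 1) \<noteq> cmod (\<chi> h - 1)"
      using cmod_power_diff_one_eq[OF z1, of 4] z by (auto simp: numeral_eq_Suc)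
    ultimately show ?thesis using that by blast
  next
    assume "\<not> 3 dvd ord h"
    then have "coprime 3 (ord h)" by (intro prime_imp_coprime) simp_all
    moreover have "cmod (\<chi> h ^ 3 - 1) \<noteq> cmod (\<chi> h - 1)"
      using cmod_power_diff_one_eq[OF z1, of 2] z z2 by (auto simp: numeral_eq_Suc)
    ultimately show ?thesis using that by blast
  qed
  have "\<chi> h ^ k \<noteq> 1"
    using power_coprime_eq_1[OF k, of "\<chi> h"] char_pow_ord[OF \<chi> h] ne by auto
  then have "ln (cmod (\<chi> h ^ k - 1)) \<noteq> ln (cmod (\<chi> h - 1))"
    using ne_k ne by (subst ln_inj_iff) auto
  moreover have "totient (ord h) > 0" using ord_ge_1[OF fin h] by simp
  moreover obtain u where "u \<in> Units ZG"
    "log_ev \<chi> u = totient (ord h) * (ln (cmod (\<chi> h ^ k - 1)) - ln (cmod (\<chi> h - 1)))"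
    using bass_unit[OF h k] \<chi> ne by blast
  ultimately show ?thesis by (intro bexI[of _ u]) simp_all
qed

text \<open>Otherwise the unit isolated from \<open>u\<close> by \<open>t\<close> has nonzero
  logarithm at \<open>\<chi>\<close> and logarithm 0 at \<open>\<psi>\<close>, while
  \<open>\<psi>\<close> has a nonzero logarithm on some other unit. This violates
  proportionality.\<close>

lemma big_kernels:
  assumes "ecut G" "big \<chi>" "big \<psi>" "t \<in> carrier G" "\<chi> t = 1"
  shows "\<psi> t = 1"
proof (rule ccontr)
  assume ne: "\<psi> t \<noteq> 1"
  have \<chi>: "\<chi> \<in> characters" and \<psi>: "\<psi> \<in> characters" using assms by (simp_all add: big_def)
  obtain u where u: "u \<in> Units ZG" "log_ev \<chi> u \<noteq> 0" using big_unit assms by blast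
  obtain w where w: "w \<in> Units ZG" "log_ev \<psi> w \<noteq> 0" using big_unit assms by blast
  obtain v and m :: nat where v: "v \<in> Units ZG" "m > 0"
    "\<forall>\<chi>\<in>characters. log_ev \<chi> v = (if \<chi> t = 1 then real m * log_ev \<chi> u else 0)"
    using isolate_unit[OF u(1) assms(4)] by blast
  have "log_ev \<chi> v \<noteq> 0" "log_ev \<psi> v = 0" using v \<chi> \<psi> u assms(5) ne by simp_all
  then show False using log_ev_proportional[OF assms(1) \<chi> \<psi> v(1) w(1)] w(2) by simp
qed

text \<open>If \<open>\<theta>\<close> does not kill \<open>t\<close>, neither does
  \<open>\<chi> \<theta>\<close>, so by \<open>big_kernels\<close> neither is big and each has order
  dividing 4 or 6. A common exponent would also be one for \<open>\<chi>\<close>; mixed exponents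
  produce a character of order at most 2 that does not kill \<open>t\<close>.\<close>

lemma big_injective:
  assumes "ecut G" "big \<chi>" "t \<in> carrier G" "\<chi> t = 1"
  shows "t = \<one>"
proof (rule ccontr)
  assume "t \<noteq> \<one>"
  then obtain \<theta> where \<theta>: "\<theta> \<in> characters" "\<theta> t \<noteq> 1" using char_separates assms(3) by blast
  have \<chi>: "\<chi> \<in> characters" using assms by (simp add: big_def)
  have small: "(\<forall>x\<in>carrier G. \<phi> x ^ 4 = 1) \<or> (\<forall>x\<in>carrier G. \<phi> x ^ 6 = 1)"
    if "\<phi> \<in> characters" "\<phi> t \<noteq> 1" for \<phi>
    using that big_kernels[OF assms(1,2) _ assms(3,4)] not_bigD by blast
  define \<phi> where "\<phi> = (\<lambda>x. \<chi> x * \<theta> x)"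
  have \<phi>: "\<phi> \<in> characters" "\<phi> t \<noteq> 1" using char_times[OF \<chi> \<theta>(1)] \<theta>(2) assms(4) by (simp_all add: \<phi>_def)
  \<comment> \<open>Twisting \<open>\<chi>\<close> by a character with square 1 changes neither
    fourth nor sixth powers, so the product is still big and must kill \<open>t\<close>.\<close>
  have quad: "\<not> (\<forall>x\<in>carrier G. \<eta> x ^ 2 = 1)" if \<eta>: "\<eta> \<in> characters" "\<eta> t \<noteq> 1" for \<eta>
  proof
    assume sq: "\<forall>x\<in>carrier G. \<eta> x ^ 2 = 1"
    have "(\<chi> x * \<eta> x) ^ 4 = \<chi> x ^ 4" "(\<chi> x * \<eta> x) ^ 6 = \<chi> x ^ 6" if "x \<in> carrier G" for x
    proof -
      have "\<eta> x ^ 4 = (\<eta> x ^ 2) ^ 2" "\<eta> x ^ 6 = (\<eta> x ^ 2) ^ 3" by (simp_all flip: power_mult)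
      then show "(\<chi> x * \<eta> x) ^ 4 = \<chi> x ^ 4" "(\<chi> x * \<eta> x) ^ 6 = \<chi> x ^ 6"
        using sq that by (simp_all add: power_mult_distrib)
    qed
    then have "big (\<lambda>x. \<chi> x * \<eta> x)"
      using assms(2) char_times[OF \<chi> \<eta>(1)] by (auto simp: big_def)
    then show False using big_kernels[OF assms(1,2) _ assms(3,4)] \<eta>(2) assms(4) by fastforce
  qed
  have \<theta>0: "\<theta> x \<noteq> 0" if "x \<in> carrier G" for x using char_nonzero[OF \<theta>(1) that] .
  consider (a) "\<forall>x\<in>carrier G. \<theta> x ^ 4 = 1 \<and> \<phi> x ^ 4 = 1" | (b) "\<forall>x\<in>carrier G. \<theta> x ^ 6 = 1 \<and> \<phi> x ^ 6 = 1"
    | (c) "\<forall>x\<in>carrier G. \<theta> x ^ 4 = 1 \<and> \<phi> x ^ 6 = 1" | (d) "\<forall>x\<in>carrier G. \<theta> x ^ 6 = 1 \<and> \<phi> x ^ 4 = 1"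
    using small[OF \<theta>] small[OF \<phi>] by blast
  then show False
  proof cases
    case a
    have "\<chi> x ^ 4 = 1" if "x \<in> carrier G" for x
      using bspec[OF a that] by (auto simp: \<phi>_def power_mult_distrib)
    then show ?thesis using assms(2) by (auto simp: big_def)
  next
    case b
    have "\<chi> x ^ 6 = 1" if "x \<in> carrier G" for x
      using bspec[OF b that] by (auto simp: \<phi>_def power_mult_distrib)
    then show ?thesis using assms(2) by (auto simp: big_def)
  next
    case c
    \<comment> \<open>The square of \<open>\<chi>^3 \<theta>\<close> is
      \<open>\<chi>^6 \<theta>^2 = \<phi>^6 / \<theta>^4 = 1\<close>, and at \<open>t\<close> this
      character agrees with \<open>\<theta>\<close>.\<close>
    define \<eta> where "\<eta> x = (if x \<in> carrier G then \<chi> x ^ 3 else 0) * \<theta> x" for x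
    have "\<eta> \<in> characters" using char_times[OF char_power[OF \<chi>] \<theta>(1)] by (simp add: \<eta>_def[abs_def])
    moreover have "\<eta> t \<noteq> 1" using \<theta>(2) assms(3,4) by (simp add: \<eta>_def)
    moreover have "\<eta> x ^ 2 = 1" if x: "x \<in> carrier G" for x
    proof -
      have "\<eta> x ^ 2 * \<theta> x ^ 4 = \<phi> x ^ 6"
        using x by (simp add: \<eta>_def \<phi>_def power_mult_distrib mult.assoc flip: power_mult power_add)
      then show ?thesis using c x by simp
    qed
    ultimately show ?thesis using quad by blast
  next
    case d
    \<comment> \<open>\<open>\<theta>^3\<close> has square 1. At \<open>t\<close> the characters
      \<open>\<theta>\<close> and \<open>\<phi>\<close> agree, so the fourth and sixth powers of
      \<open>\<theta> t\<close> are 1; hence its square is 1 and its cube is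
      \<open>\<theta> t\<close> itself.\<close>
    define \<eta> where "\<eta> x = (if x \<in> carrier G then \<theta> x ^ 3 else 0)" for x
    have "\<eta> \<in> characters" using char_power[OF \<theta>(1)] by (simp add: \<eta>_def[abs_def])
    moreover have "\<theta> t ^ 2 = 1"
    proof -
      have 46: "\<theta> t ^ 4 = 1" "\<theta> t ^ 6 = 1"
        using bspec[OF d assms(3)] assms(4) by (auto simp: \<phi>_def)
      have "\<theta> t ^ 2 = \<theta> t ^ 4 * \<theta> t ^ 2" unfolding 46 by simp
      also have "\<dots> = \<theta> t ^ 6" by (simp flip: power_add)
      finally show ?thesis unfolding 46 .
    qed
    then have "\<eta> t \<noteq> 1"
      using \<theta>(2) assms(3) by (simp add: \<eta>_def power3_eq_cube power2_eq_square)
    moreover have "\<eta> x ^ 2 = 1" if "x \<in> carrier G" for x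
      using d that by (simp add: \<eta>_def flip: power_mult)
    ultimately show ?thesis using quad by blast
  qed
qed

text \<open>By \<open>big_injective\<close> the image of \<open>\<chi>\<close> consists of
  \<open>n\<close> solutions of \<open>z ^ n = 1\<close>, hence of all of them, and a preimage of
  the primitive root \<open>\<omega>\<close> generates \<open>G\<close>.\<close>

lemma ecut_imp_cyclic:
  assumes ecut: "ecut G" and big: "big \<chi>"
  shows "cyclic_group G \<and> order G \<in> {5, 8, 12}"
proof -
  have \<chi>: "\<chi> \<in> characters" using big by (simp add: big_def)
  define n where "n = order G"
  define \<omega> where "\<omega> = cis (2 * pi / n)"
  have n0: "n > 0" using fin by (simp add: n_def order_gt_0_iff_finite)
  have \<omega>: "\<omega> ^ k = 1 \<longleftrightarrow> n dvd k" for k unfolding \<omega>_def using n0 by (rule cis_power_eq_1_iff)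
  have inj: "inj_on \<chi> (carrier G)"
  proof (rule inj_onI)
    fix x y assume xy: "x \<in> carrier G" "y \<in> carrier G" "\<chi> x = \<chi> y"
    have "\<chi> (x \<otimes> inv y) = \<chi> (y \<otimes> inv y)" using xy char_mult[OF \<chi>, of x "inv y"] char_mult[OF \<chi>, of y "inv y"] by simp
    then have "x \<otimes> inv y = \<one>" using big_injective[OF ecut big, of "x \<otimes> inv y"] xy \<chi> by (simp add: char_one)
    then show "x = y" using xy by (metis inv_closed inv_equality inv_inv)
  qed
  have root: "\<chi> x ^ n = 1" if "x \<in> carrier G" for x
    using that \<chi> by (simp add: n_def char_pow[symmetric] pow_order_eq_1 char_one)
  have "\<chi> ` carrier G = {z. z ^ n = 1}"
  proof (rule card_subset_eq)
    show "finite {z::complex. z ^ n = 1}" using n0 by (intro finite_roots_unity) simp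
    show "card (\<chi> ` carrier G) = card {z::complex. z ^ n = 1}"
      using n0 by (simp add: card_image[OF inj] card_roots_unity_eq) (simp add: n_def order_def)
  qed (use root in auto)
  moreover have "\<omega> ^ n = 1" by (simp add: \<omega>)
  ultimately obtain g where g: "g \<in> carrier G" "\<chi> g = \<omega>" by (metis (mono_tags, lifting) imageE mem_Collect_eq)
  have gen: "\<exists>k::nat. x = g [^] k" if x: "x \<in> carrier G" for x
  proof -
    have "\<chi> x \<in> (\<lambda>k. cis (2 * pi * real k / real n)) ` {..<n}"
      using bij_betw_imp_surj_on[OF bij_betw_roots_unity[OF n0]] root[OF x] by blast
    then obtain k where "\<chi> x = cis (2 * pi * real k / real n)" by blast
    then have "\<chi> x = \<chi> (g [^] k)" using g \<chi> by (simp add: char_pow \<omega>_def DeMoivre mult.commute)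
    then show ?thesis using inj_onD[OF inj] x g by blast
  qed
  have "carrier G = range (\<lambda>k::int. g [^] k)"
  proof (intro equalityI subsetI)
    fix x assume "x \<in> carrier G"
    then obtain k :: nat where "x = g [^] k" using gen by blast
    then have "x = g [^] int k" by (simp add: int_pow_int)
    then show "x \<in> range (\<lambda>k::int. g [^] k)" by blast
  qed (use g in auto)
  then have cyc: "cyclic_group G" using cyclic_group g(1) by blast
  have ord_g: "ord g = n"
  proof (rule dvd_antisym)
    show "ord g dvd n" using g ord_dvd_group_order by (simp add: n_def)
    show "n dvd ord g" using char_pow_ord[OF \<chi> g(1)] g(2) \<omega> by simp
  qed
  obtain h where h: "h \<in> carrier G" "\<chi> h ^ 4 \<noteq> 1" "\<chi> h ^ 6 \<noteq> 1" using big by (auto simp: big_def)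
  have "n \<in> {5, 8, 12}"
  proof (rule divisors_8_12_cases[OF n0])
    show "\<not> n dvd 4" using root[OF h(1)] h(2) by (metis dvdE power_mult power_one)
    show "\<not> n dvd 6" using root[OF h(1)] h(3) by (metis dvdE power_mult power_one)
    show "odd n \<Longrightarrow> n < 7" using ecut_imp_odd_order_less[OF ecut g(1)] ord_g by simp
    \<comment> \<open>For even \<open>n\<close> the square of \<open>\<chi>\<close> kills
      \<open>g^(n/2)\<close>, which \<open>\<chi>\<close> does not, so by \<open>big_kernels\<close>
      it is not big; this makes \<open>n\<close> a divisor of 8 or 12.\<close>
    assume "even n"
    then obtain m where m: "n = 2 * m" by blast
    define \<phi> where "\<phi> = (\<lambda>x. if x \<in> carrier G then \<chi> x ^ 2 else 0)"
    have \<phi>: "\<phi> \<in> characters" using char_power[OF \<chi>] by (simp add: \<phi>_def)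
    have gm: "g [^] m \<in> carrier G" using g by simp
    have "\<phi> (g [^] m) = \<omega> ^ (m * 2)" using g \<chi> by (simp add: \<phi>_def char_pow flip: power_mult)
    then have 1: "\<phi> (g [^] m) = 1" using \<omega> m by simp
    have "\<chi> (g [^] m) = \<omega> ^ m" using g \<chi> by (simp add: char_pow)
    then have "\<chi> (g [^] m) \<noteq> 1" using \<omega> m n0 by (auto dest: dvd_imp_le)
    then have "\<not> big \<phi>" using big_kernels[OF ecut _ big gm, of \<phi>] 1 by blast
    then have "\<phi> g ^ 4 = 1 \<or> \<phi> g ^ 6 = 1" using not_bigD[OF \<phi>] g by blast
    moreover have "\<phi> g ^ 4 = \<omega> ^ 8" "\<phi> g ^ 6 = \<omega> ^ 12" using g by (simp_all add: \<phi>_def flip: power_mult)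
    ultimately show "n dvd 8 \<or> n dvd 12" using \<omega> by simp
  qed
  then show ?thesis using cyc by (simp add: n_def)
qed

section \<open>The exponent of the group and the final equivalence\<close>

lemma group_exponent_dvd_iff:
  assumes "m > 0"
  shows "group_exponent G dvd m \<longleftrightarrow> (\<forall>x\<in>carrier G. x [^] m = \<one>)"
proof -
  define e where "e = group_exponent G"
  have ex: "0 < order G \<and> (\<forall>x\<in>carrier G. x [^] order G = \<one>)"
    using fin pow_order_eq_1 by (simp add: order_gt_0_iff_finite)
  have e: "0 < e \<and> (\<forall>x\<in>carrier G. x [^] e = \<one>)"
    unfolding e_def group_exponent_def using ex by (rule LeastI)
  have red: "x [^] m = x [^] (m mod e)" if x: "x \<in> carrier G" for x
  proof -
    have "x [^] m = x [^] (e * (m div e) + m mod e)" by simp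
    also have "\<dots> = (x [^] e) [^] (m div e) \<otimes> x [^] (m mod e)"
      using x by (simp only: nat_pow_mult nat_pow_pow)
    also have "\<dots> = x [^] (m mod e)" using e x by simp
    finally show ?thesis .
  qed
  show ?thesis unfolding e_def[symmetric]
  proof
    assume "e dvd m"
    then show "\<forall>x\<in>carrier G. x [^] m = \<one>" using red by simp
  next
    assume "\<forall>x\<in>carrier G. x [^] m = \<one>"
    then have one: "\<forall>x\<in>carrier G. x [^] (m mod e) = \<one>" using red by simp
    have "m mod e < e" using e by simp
    then have "\<not> (0 < m mod e \<and> (\<forall>x\<in>carrier G. x [^] (m mod e) = \<one>))"
      unfolding e_def group_exponent_def by (rule not_less_Least)
    then have "\<not> 0 < m mod e" using one by simp
    then show "e dvd m" by auto
  qed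
qed

end

theorem theorem3p7:
  fixes G :: "'a monoid"
  assumes "comm_group G" and "finite (carrier G)"
  shows "ecut G \<longleftrightarrow>
           (cyclic_group G \<and> order G \<in> {5, 8, 12}) \<or>
           group_exponent G dvd 4 \<or> group_exponent G dvd 6"
proof -
  interpret finite_comm_group G
    using assms by (intro finite_comm_group.intro finite_comm_group_axioms.intro)
  have exp: "group_exponent G dvd 4 \<longleftrightarrow> (\<forall>x\<in>carrier G. x [^]\<^bsub>G\<^esub> (4::nat) = \<one>\<^bsub>G\<^esub>)"
    "group_exponent G dvd 6 \<longleftrightarrow> (\<forall>x\<in>carrier G. x [^]\<^bsub>G\<^esub> (6::nat) = \<one>\<^bsub>G\<^esub>)"
    by (simp_all add: group_exponent_dvd_iff)
  show ?thesis
  proof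
    assume "ecut G"
    then show "(cyclic_group G \<and> order G \<in> {5, 8, 12}) \<or> group_exponent G dvd 4 \<or> group_exponent G dvd 6"
      unfolding exp using big_exists ecut_imp_cyclic by blast
  next
    assume "(cyclic_group G \<and> order G \<in> {5, 8, 12}) \<or> group_exponent G dvd 4 \<or> group_exponent G dvd 6"
    then show "ecut G"
      unfolding exp using ecut_small_exponent ecut_small_cyclic by blast
  qed
qed

end
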